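(* Let $K$ be a field, let $d\ge 1$, and fix a monomial ordering on $K[x_1,\dots,x_d]$. Then every rational function $f\in K(x_1,\dots,x_d)$ can be written as a finite sum of rational functions that are linearly independent over $K$, each of the form $$\frac{r}{\prod_{i\in S}q_i^{b_i}},$$ where $S$ is a finite (possibly empty) index set, $r\in K[x_1,\dots,x_d]$, the $b_i$ are positive integers and the $q_i$ are pairwise non-associate irreducible polynomials in $K[x_1,\dots,x_d]$ (all depending on the summand), such that for each summand: 1. the denominator polynomials $q_i$, $i\in S$, have a common zero in $\overline{K}^d$; 2. the set $\{q_i \mid i\in S\}$ is algebraically independent over $K$; 3. the numerator polynomial $r$ is not divisible by the leading term $\mathrm{LT}(q_i)$ of any of the denominator polynomials $q_i$, $i\in S$.
   Context: $\overline{K}$ is an algebraic closure of $K$. A finite set of polynomials $\{g_1,\dots,g_n\}\subset K[x_1,\dots,x_d]$ is algebraically independent if there is no nonzero polynomial $\kappa$ in $n$ variables over $K$ with $\kappa(g_1,\dots,g_n)=0$. A monomial ordering is a total order on exponents in $\mathbb{Z}_{\ge 0}^d$ that is compatible with addition and is a well-ordering; $\mathrm{LT}(g)$ is the leading term (leading coefficient times leading monomial) of a nonzero polynomial $g$ with respect to this ordering. For an empty index set $S$ the denominator is $1$ and conditions 1–3 are vacuous; the zero function corresponds to the empty sum. *)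

theory Defs
  imports
    "HOL-Library.Poly_Mapping"
    "HOL-Computational_Algebra.Fraction_Field"
    "HOL-Algebra.Algebraic_Closure_Type"
begin

text \<open>
  For a finite type \<open>'n\<close> with \<open>d\<close> elements, \<open>('a, 'n) mpoly\<close> is the polynomial ring
  \<open>K[x\<^sub>1,\<dots>,x\<^sub>d]\<close>: a polynomial maps exponent vectors to coefficients, with finite support, and
  \<open>*\<close> is convolution. Its field of fractions is \<open>('a, 'n) mpoly fract\<close>. The sort \<open>linorder\<close> on
  \<open>'n\<close>, where it appears, only serves the library's \<open>idom\<close> instance; it is unrelated to the
  monomial ordering.
\<close>

type_synonym ('a, 'n) mpoly = "('n \<Rightarrow>\<^sub>0 nat) \<Rightarrow>\<^sub>0 'a"

definition mp_const :: "'a::zero \<Rightarrow> ('a, 'n) mpoly"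
  where "mp_const c = Poly_Mapping.single 0 c"

text \<open>Evaluation at \<open>x\<close>, with coefficients mapped into the target ring by \<open>h\<close>.\<close>

definition mp_eval :: "('a::zero \<Rightarrow> 'b::comm_semiring_1) \<Rightarrow> ('i \<Rightarrow> 'b) \<Rightarrow> ('a, 'i) mpoly \<Rightarrow> 'b"
  where "mp_eval h x p =
    (\<Sum>m\<in>Poly_Mapping.keys p. h (Poly_Mapping.lookup p m) *
      (\<Prod>i\<in>Poly_Mapping.keys m. x i ^ Poly_Mapping.lookup m i))"

definition mp_vars :: "('a::zero, 'i) mpoly \<Rightarrow> 'i set"
  where "mp_vars p = (\<Union>m\<in>Poly_Mapping.keys p. Poly_Mapping.keys m)"

text \<open>
  The variables of the annihilating polynomial are named by the indices of the family. When
  \<open>g\<close> is injective on \<open>I\<close>, this is algebraic independence of the set \<open>g ` I\<close>.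
\<close>

definition alg_independent :: "'i set \<Rightarrow> ('i \<Rightarrow> ('a::comm_ring_1, 'n) mpoly) \<Rightarrow> bool"
  where "alg_independent I g \<longleftrightarrow>
    \<not> (\<exists>\<kappa> :: ('a, 'i) mpoly. \<kappa> \<noteq> 0 \<and> mp_vars \<kappa> \<subseteq> I \<and> mp_eval mp_const g \<kappa> = 0)"

text \<open>A relation \<open>R\<close> is read as \<open>(s, t) \<in> R\<close> iff \<open>s \<le> t\<close>.\<close>

definition monomial_ordering :: "(('n \<Rightarrow>\<^sub>0 nat) \<times> ('n \<Rightarrow>\<^sub>0 nat)) set \<Rightarrow> bool"
  where "monomial_ordering R \<longleftrightarrow>
    well_order_on UNIV R \<and> (\<forall>s t u. (s, t) \<in> R \<longrightarrow> (s + u, t + u) \<in> R)"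

text \<open>The leading exponent and term are only meaningful for nonzero polynomials.\<close>

definition lead_exp ::
    "(('n \<Rightarrow>\<^sub>0 nat) \<times> ('n \<Rightarrow>\<^sub>0 nat)) set \<Rightarrow> ('a::zero, 'n) mpoly \<Rightarrow> ('n \<Rightarrow>\<^sub>0 nat)"
  where "lead_exp R g =
    (THE m. m \<in> Poly_Mapping.keys g \<and> (\<forall>m'\<in>Poly_Mapping.keys g. (m', m) \<in> R))"

definition lead_term ::
    "(('n \<Rightarrow>\<^sub>0 nat) \<times> ('n \<Rightarrow>\<^sub>0 nat)) set \<Rightarrow> ('a::zero, 'n) mpoly \<Rightarrow> ('a, 'n) mpoly"
  where "lead_term R g =
    Poly_Mapping.single (lead_exp R g) (Poly_Mapping.lookup g (lead_exp R g))"

definition fract_scale ::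
    "'a::field \<Rightarrow> ('a, 'n::linorder) mpoly fract \<Rightarrow> ('a, 'n) mpoly fract"
  where "fract_scale c x = Fract (mp_const c) 1 * x"

global_interpretation fract_space: vector_space
    "fract_scale :: 'a::field \<Rightarrow> ('a, 'n::linorder) mpoly fract \<Rightarrow> ('a, 'n) mpoly fract"
proof
  fix a b :: 'a and x y :: "('a, 'n) mpoly fract"
  show "fract_scale a (x + y) = fract_scale a x + fract_scale a y"
    by (simp add: fract_scale_def distrib_left)
  show "fract_scale (a + b) x = fract_scale a x + fract_scale b x"
    by (simp add: fract_scale_def mp_const_def Poly_Mapping.single_add distrib_right[symmetric])
  show "fract_scale a (fract_scale b x) = fract_scale (a * b) x"
    by (simp add: fract_scale_def mp_const_def Poly_Mapping.mult_single mult.assoc[symmetric])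
  show "fract_scale 1 x = x"
    by (simp add: fract_scale_def mp_const_def One_fract_def[symmetric])
qed

end

theory Submission
  imports Defs "Jordan_Normal_Form.Char_Poly"
begin

text \<open>
  The fractions of the required shape are stable under nonzero scalars, so it suffices that they
  span the field: an arbitrary linear combination can then be rewritten over a linearly
  independent subset, with the coefficients absorbed into the summands.

  To reach the span, factor the denominator as a product of \<open>q\<^sub>i\<^bsup>b\<^sub>i\<^esup>\<close> and induct on the number of
  factors. If the \<open>q\<^sub>i\<close> have no common zero, the Nullstellensatz gives
  \<open>1 = \<Sum> h\<^sub>i q\<^sub>i\<^bsup>b\<^sub>i\<^esup>\<close>, and each term cancels one factor. If they satisfy an algebraic relation, order
  its monomials by a weight \<open>w\<close> that separates them and solve for the lightest one, \<open>q\<^bsup>\<alpha>\<^esup>\<close>; the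
  \<open>t\<close>-th power of this equation expresses \<open>q\<^bsup>t\<alpha>\<^esup>\<close> through monomials of weight at least
  \<open>t (w \<cdot> \<alpha> + 1)\<close>, so that for large \<open>t\<close> each term cancels some \<open>q\<^sub>i\<^bsup>b\<^sub>i + t\<alpha>\<^sub>i\<^esup>\<close>. Otherwise, whenever
  \<open>LT(q\<^sub>i)\<close> divides the numerator, subtracting a multiple of \<open>q\<^sub>i\<close> lowers either \<open>b\<^sub>i\<close> or the leading
  exponent of the numerator.

  For the Nullstellensatz, a point is constructed one coordinate at a time over an algebraically
  closed field: after a change of variables \<open>y\<^sub>i - y\<^sub>v\<^bsup>w\<^sub>i\<^esup>\<close> a given relation becomes monic in \<open>y\<^sub>v\<close>, and
  a Euclidean elimination against it shows that the specialized ideal of univariate polynomials is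
  proper. A linear functional on the algebraic closure brings the certificate back to \<open>K\<close>.
\<close>

section \<open>Evaluation of polynomials\<close>

definition mp_var :: "'i \<Rightarrow> ('a::zero_neq_one, 'i) mpoly"
  where "mp_var i = Poly_Mapping.single (Poly_Mapping.single i 1) 1"

definition mon_eval :: "('i \<Rightarrow> 'b::comm_semiring_1) \<Rightarrow> ('i \<Rightarrow>\<^sub>0 nat) \<Rightarrow> 'b"
  where "mon_eval x m = (\<Prod>i\<in>Poly_Mapping.keys m. x i ^ Poly_Mapping.lookup m i)"

lemma mp_eval_altdef:
  "mp_eval h x p = (\<Sum>m\<in>Poly_Mapping.keys p. h (Poly_Mapping.lookup p m) * mon_eval x m)"
  by (simp add: mp_eval_def mon_eval_def)

lemma mon_eval_superset:
  assumes "finite A" "Poly_Mapping.keys m \<subseteq> A"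
  shows "mon_eval x m = (\<Prod>i\<in>A. x i ^ Poly_Mapping.lookup m i)"
  unfolding mon_eval_def
  by (rule prod.mono_neutral_left) (use assms in \<open>auto simp: in_keys_iff\<close>)

lemma mon_eval_0 [simp]: "mon_eval x 0 = 1"
  by (simp add: mon_eval_def)

lemma mon_eval_add: "mon_eval x (m + n) = mon_eval x m * mon_eval x n"
proof -
  let ?A = "Poly_Mapping.keys m \<union> Poly_Mapping.keys n"
  have "mon_eval x (m + n) = (\<Prod>i\<in>?A. x i ^ Poly_Mapping.lookup (m + n) i)"
    by (rule mon_eval_superset) (use Poly_Mapping.keys_add[of m n] in auto)
  also have "\<dots> = (\<Prod>i\<in>?A. x i ^ Poly_Mapping.lookup m i) * (\<Prod>i\<in>?A. x i ^ Poly_Mapping.lookup n i)"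
    by (simp add: lookup_add power_add prod.distrib)
  also have "\<dots> = mon_eval x m * mon_eval x n"
    by (simp add: mon_eval_superset[symmetric])
  finally show ?thesis .
qed

lemma mp_eval_superset:
  assumes "finite A" "Poly_Mapping.keys p \<subseteq> A" "h 0 = 0"
  shows "mp_eval h x p = (\<Sum>m\<in>A. h (Poly_Mapping.lookup p m) * mon_eval x m)"
  unfolding mp_eval_altdef
  by (rule sum.mono_neutral_left) (use assms in \<open>auto simp: in_keys_iff\<close>)

lemma mp_eval_single: "h 0 = 0 \<Longrightarrow> mp_eval h x (Poly_Mapping.single m c) = h c * mon_eval x m"
  by (cases "c = 0") (simp_all add: mp_eval_altdef)

lemma poly_mapping_eq_sum_single:
  "p = (\<Sum>m\<in>Poly_Mapping.keys p. Poly_Mapping.single m (Poly_Mapping.lookup p m))"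
proof (rule poly_mapping_eqI)
  fix k
  have "Poly_Mapping.lookup (\<Sum>m\<in>Poly_Mapping.keys p. Poly_Mapping.single m (Poly_Mapping.lookup p m)) k
    = (\<Sum>m\<in>Poly_Mapping.keys p. if m = k then Poly_Mapping.lookup p k else 0)"
    unfolding lookup_sum by (intro sum.cong refl) (simp add: lookup_single when_def)
  also have "\<dots> = Poly_Mapping.lookup p k"
    by (simp add: in_keys_iff)
  finally show "Poly_Mapping.lookup p k = Poly_Mapping.lookup
      (\<Sum>m\<in>Poly_Mapping.keys p. Poly_Mapping.single m (Poly_Mapping.lookup p m)) k" ..
qed

text \<open>A polynomial is a finite sum of its terms, and the empty sum is a term with coefficient
  0. Identities that are additive in \<open>p\<close> therefore need checking on single terms
  only.\<close>

lemma poly_mapping_single_add_induct [case_names single add]: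
  fixes p :: "'a \<Rightarrow>\<^sub>0 'b::comm_monoid_add"
  assumes "\<And>m c. P (Poly_Mapping.single m c)" "\<And>p q. P p \<Longrightarrow> P q \<Longrightarrow> P (p + q)"
  shows "P p"
proof -
  have zero: "P 0"
    using assms(1)[of undefined 0] by simp
  have "P (\<Sum>m\<in>A. Poly_Mapping.single m (Poly_Mapping.lookup p m))" if "finite A" for A
    using that by induction (simp_all add: zero assms)
  then show ?thesis
    by (subst poly_mapping_eq_sum_single) simp
qed

lemma mp_eval_add:
  assumes "comm_ring_hom h"
  shows "mp_eval h x (p + q) = mp_eval h x p + mp_eval h x q"
proof -
  interpret comm_ring_hom h by fact
  let ?A = "Poly_Mapping.keys p \<union> Poly_Mapping.keys q"
  have "mp_eval h x (p + q) = (\<Sum>m\<in>?A. h (Poly_Mapping.lookup (p + q) m) * mon_eval x m)"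
    by (rule mp_eval_superset) (use Poly_Mapping.keys_add[of p q] in auto)
  also have "\<dots> = (\<Sum>m\<in>?A. h (Poly_Mapping.lookup p m) * mon_eval x m)
      + (\<Sum>m\<in>?A. h (Poly_Mapping.lookup q m) * mon_eval x m)"
    by (simp add: lookup_add hom_add distrib_right sum.distrib)
  also have "\<dots> = mp_eval h x p + mp_eval h x q"
    by (simp add: mp_eval_superset[symmetric])
  finally show ?thesis .
qed

text \<open>Both sides are additive in each factor, so two inductions reduce the claim to products
  of single terms, where \<open>mon_eval_add\<close> settles it.\<close>

lemma mp_eval_mult:
  assumes "comm_ring_hom h"
  shows "mp_eval h x (p * q) = mp_eval h x p * mp_eval h x q"
proof -
  interpret comm_ring_hom h by fact
  have single: "mp_eval h x (Poly_Mapping.single m c * q) = mp_eval h x (Poly_Mapping.single m c) * mp_eval h x q"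
    for m c
    by (induction q rule: poly_mapping_single_add_induct)
      (simp_all add: mult_single mp_eval_single mon_eval_add hom_mult distrib_left mp_eval_add[OF assms] mult.assoc mult.left_commute)
  show ?thesis
    by (induction p rule: poly_mapping_single_add_induct)
      (simp_all add: single distrib_right mp_eval_add[OF assms])
qed

lemma comm_ring_hom_mp_eval:
  assumes "comm_ring_hom h"
  shows "comm_ring_hom (mp_eval h x)"
proof -
  interpret comm_ring_hom h by fact
  show ?thesis
  proof
    show "mp_eval h x 1 = 1"
      by (simp add: mp_eval_altdef)
    show "mp_eval h x 0 = 0"
      by (simp add: mp_eval_altdef)
  qed (simp_all add: mp_eval_add[OF assms] mp_eval_mult[OF assms])
qed

lemma hom_mon_eval:
  assumes "comm_ring_hom \<phi>"
  shows "\<phi> (mon_eval x m) = mon_eval (\<lambda>i. \<phi> (x i)) m"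
proof -
  interpret comm_ring_hom \<phi> by fact
  show ?thesis
    by (simp add: mon_eval_def hom_prod hom_power)
qed

text \<open>Turns a composite of substitutions into one evaluation; changes of variables,
  specializations and extensions of scalars are all computed with it.\<close>

lemma hom_mp_eval:
  assumes "comm_ring_hom \<phi>"
  shows "\<phi> (mp_eval h x p) = mp_eval (\<lambda>c. \<phi> (h c)) (\<lambda>i. \<phi> (x i)) p"
proof -
  interpret comm_ring_hom \<phi> by fact
  show ?thesis
    by (simp add: mp_eval_altdef hom_sum hom_mult hom_mon_eval[OF assms])
qed

lemma comm_ring_hom_mp_const: "comm_ring_hom (mp_const :: 'a::comm_ring_1 \<Rightarrow> ('a, 'i) mpoly)"
  by standard (simp_all add: mp_const_def Poly_Mapping.single_add mult_single)

lemma mon_eval_mp_var: "mon_eval mp_var m = (Poly_Mapping.single m 1 :: ('a::comm_ring_1, 'i) mpoly)"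
proof -
  have pow: "(mp_var i :: ('a, 'i) mpoly) ^ k = Poly_Mapping.single (Poly_Mapping.single i k) 1" for i k
    by (induction k) (simp_all add: mp_var_def mult_single Poly_Mapping.single_add[symmetric])
  have "(\<Prod>i\<in>A. (mp_var i :: ('a, 'i) mpoly) ^ Poly_Mapping.lookup m i) =
      Poly_Mapping.single (\<Sum>i\<in>A. Poly_Mapping.single i (Poly_Mapping.lookup m i)) 1" if "finite A" for A
    using that by induction (simp_all add: pow mult_single)
  then show ?thesis
    by (simp add: mon_eval_def poly_mapping_eq_sum_single[symmetric])
qed

lemma mp_eval_mp_var: "mp_eval mp_const mp_var p = (p :: ('a::comm_ring_1, 'i) mpoly)"
proof -
  have "mp_eval mp_const mp_var p = (\<Sum>m\<in>Poly_Mapping.keys p. Poly_Mapping.single m (Poly_Mapping.lookup p m))"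
    by (simp add: mp_eval_altdef mon_eval_mp_var mp_const_def mult_single)
  then show ?thesis
    by (simp add: poly_mapping_eq_sum_single[symmetric])
qed

section \<open>Variables occurring in a polynomial, and separating weights\<close>

lemma mp_vars_add: "mp_vars (p + q) \<subseteq> mp_vars p \<union> mp_vars q"
  using Poly_Mapping.keys_add[of p q] by (auto simp: mp_vars_def)

lemma mp_vars_mult: "mp_vars (p * q) \<subseteq> mp_vars (p :: ('a::comm_ring_1, 'i) mpoly) \<union> mp_vars q"
proof
  fix i assume "i \<in> mp_vars (p * q)"
  then obtain m n where "m \<in> Poly_Mapping.keys p" "n \<in> Poly_Mapping.keys q" "i \<in> Poly_Mapping.keys (m + n)"
    using keys_mult[of p q] by (force simp: mp_vars_def)
  then show "i \<in> mp_vars p \<union> mp_vars q"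
    using Poly_Mapping.keys_add[of m n] by (auto simp: mp_vars_def)
qed

lemma mp_vars_mp_const [simp]: "mp_vars (mp_const c) = {}"
  by (cases "c = 0") (simp_all add: mp_vars_def mp_const_def)

lemma mp_vars_mp_var [simp]: "mp_vars (mp_var i :: ('a::zero_neq_one, 'i) mpoly) = {i}"
  by (simp add: mp_vars_def mp_var_def)

lemma mp_vars_uminus [simp]: "mp_vars (- p) = mp_vars (p :: ('a::comm_ring_1, 'i) mpoly)"
  by (simp add: mp_vars_def in_keys_iff set_eq_iff)

text \<open>The weights are place values of a mixed-radix system, so that a weighted sum determines its digits.\<close>

lemma exists_separating_weight:
  fixes M :: "('i \<Rightarrow>\<^sub>0 nat) set"
  assumes "finite V" "finite M" "v \<notin> V"
  shows "\<exists>w :: 'i \<Rightarrow> nat. w v = 1 \<and> (\<forall>i\<in>insert v V. 0 < w i) \<and> (\<forall>m\<in>M. \<forall>n\<in>M.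
    (\<Sum>i\<in>insert v V. w i * Poly_Mapping.lookup m i) = (\<Sum>i\<in>insert v V. w i * Poly_Mapping.lookup n i) \<longrightarrow>
    (\<forall>i\<in>insert v V. Poly_Mapping.lookup m i = Poly_Mapping.lookup n i))"
  using assms(1,3)
proof (induction V arbitrary: v)
  case empty
  show ?case
    by (rule exI[of _ "\<lambda>_. 1"]) simp
next
  case (insert u V)
  \<comment> \<open>The element \<open>u\<close> just added plays the distinguished role in the
    induction hypothesis, so the weights obtained cover all of \<open>insert u V\<close>.\<close>
  obtain w where pos: "\<forall>i\<in>insert u V. 0 < w i" and w: "\<And>m n. m \<in> M \<Longrightarrow> n \<in> M \<Longrightarrow>
    (\<Sum>i\<in>insert u V. w i * Poly_Mapping.lookup m i) = (\<Sum>i\<in>insert u V. w i * Poly_Mapping.lookup n i) \<Longrightarrow>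
    \<forall>i\<in>insert u V. Poly_Mapping.lookup m i = Poly_Mapping.lookup n i"
    using insert.IH[OF insert.hyps(2)] by blast
  \<comment> \<open>The base \<open>B\<close> exceeds every exponent of \<open>v\<close> in
    \<open>M\<close>, which makes that exponent the lowest digit.\<close>
  define B where "B = Suc (\<Sum>m\<in>M. Poly_Mapping.lookup m v)"
  define w' where "w' = (\<lambda>i. if i = v then 1 else B * w i)"
  have less: "Poly_Mapping.lookup m v < B" if "m \<in> M" for m
    using member_le_sum[OF that, of "\<lambda>m. Poly_Mapping.lookup m v"] assms(2) by (simp add: B_def)
  have sum: "(\<Sum>i\<in>insert v (insert u V). w' i * Poly_Mapping.lookup m i) =
      Poly_Mapping.lookup m v + B * (\<Sum>i\<in>insert u V. w i * Poly_Mapping.lookup m i)" for m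
  proof -
    have "(\<Sum>i\<in>insert u V. w' i * Poly_Mapping.lookup m i) = (\<Sum>i\<in>insert u V. B * (w i * Poly_Mapping.lookup m i))"
      by (intro sum.cong refl) (use insert.prems in \<open>auto simp: w'_def\<close>)
    then have "(\<Sum>i\<in>insert u V. w' i * Poly_Mapping.lookup m i) = B * (\<Sum>i\<in>insert u V. w i * Poly_Mapping.lookup m i)"
      by (simp only: sum_distrib_left)
    moreover have "finite (insert u V)" using insert.hyps by simp
    ultimately show ?thesis
      using insert.prems by (subst sum.insert) (simp_all add: w'_def)
  qed
  show ?case
  proof (intro exI[of _ w'] conjI ballI impI)
    show "w' v = 1" by (simp add: w'_def)
    show "0 < w' i" if "i \<in> insert v (insert u V)" for i
      using that pos by (auto simp: w'_def B_def)
    fix m n i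
    assume mn: "m \<in> M" "n \<in> M" and i: "i \<in> insert v (insert u V)"
      and eq: "(\<Sum>i\<in>insert v (insert u V). w' i * Poly_Mapping.lookup m i) =
        (\<Sum>i\<in>insert v (insert u V). w' i * Poly_Mapping.lookup n i)"
    let ?s = "\<lambda>m. \<Sum>i\<in>insert u V. w i * Poly_Mapping.lookup m i"
    have eq': "Poly_Mapping.lookup m v + B * ?s m = Poly_Mapping.lookup n v + B * ?s n"
      using eq unfolding sum .
    \<comment> \<open>The residue modulo \<open>B\<close> reads off the digit at \<open>v\<close>;
      what remains is the weighted sum handled by \<open>w\<close>.\<close>
    have "(Poly_Mapping.lookup m v + B * ?s m) mod B = Poly_Mapping.lookup m v"
         "(Poly_Mapping.lookup n v + B * ?s n) mod B = Poly_Mapping.lookup n v"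
      using less[OF mn(1)] less[OF mn(2)] by simp_all
    then have v: "Poly_Mapping.lookup m v = Poly_Mapping.lookup n v"
      using eq' by simp
    then have "?s m = ?s n"
      using eq' by (simp add: B_def del: mult_Suc)
    then show "Poly_Mapping.lookup m i = Poly_Mapping.lookup n i"
      using w[OF mn] v i by blast
  qed
qed

section \<open>The weak Nullstellensatz\<close>

definition is_ideal :: "'b::comm_ring_1 set \<Rightarrow> bool"
  where "is_ideal I \<longleftrightarrow> 0 \<in> I \<and> (\<forall>a\<in>I. \<forall>b\<in>I. a + b \<in> I) \<and> (\<forall>a\<in>I. \<forall>c. c * a \<in> I)"

lemma is_ideal_add: "is_ideal I \<Longrightarrow> a \<in> I \<Longrightarrow> b \<in> I \<Longrightarrow> a + b \<in> I"
  and is_ideal_mult: "is_ideal I \<Longrightarrow> a \<in> I \<Longrightarrow> c * a \<in> I"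
  by (auto simp: is_ideal_def)

lemma is_ideal_diff: "is_ideal I \<Longrightarrow> a \<in> I \<Longrightarrow> b \<in> I \<Longrightarrow> a - b \<in> I"
  using is_ideal_add[of I a "- 1 * b"] is_ideal_mult[of I b "- 1"] by simp

text \<open>A subset instead of a ring of its own: polynomials in a growing set of variables then
  stay in one type, as the induction on the variables demands.\<close>

definition is_subring :: "'b::comm_ring_1 set \<Rightarrow> bool"
  where "is_subring A \<longleftrightarrow> 0 \<in> A \<and> 1 \<in> A \<and> (\<forall>a\<in>A. \<forall>b\<in>A. a - b \<in> A \<and> a * b \<in> A)"

lemma is_subring_power: "is_subring A \<Longrightarrow> a \<in> A \<Longrightarrow> a ^ n \<in> A"
  by (induction n) (auto simp: is_subring_def)

lemma is_subring_sum:
  assumes "is_subring A" "\<And>x. x \<in> Y \<Longrightarrow> f x \<in> A"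
  shows "sum f Y \<in> A"
proof -
  have add: "a + b \<in> A" if "a \<in> A" "b \<in> A" for a b
  proof -
    have "0 - b \<in> A" using assms(1) that by (auto simp only: is_subring_def)
    then have "a - (0 - b) \<in> A" using assms(1) that by (auto simp only: is_subring_def)
    then show ?thesis by simp
  qed
  show ?thesis
    using assms(2) by (induction Y rule: infinite_finite_induct)
      (use assms(1) in \<open>auto simp: is_subring_def add\<close>)
qed

section \<open>Univariate polynomials over a subring and their specialization\<close>

definition polys_over :: "'b::comm_ring_1 set \<Rightarrow> 'b poly set"
  where "polys_over A = {P. \<forall>n. Polynomial.coeff P n \<in> A}"

lemma is_subring_polys_over: 
  assumes "is_subring A" shows "is_subring (polys_over A)"
  unfolding is_subring_def
proof (intro conjI ballI)
  fix P Q assume PQ: "P \<in> polys_over A" "Q \<in> polys_over A"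
  show "P - Q \<in> polys_over A"
    using PQ assms by (auto simp: polys_over_def is_subring_def)
  show "P * Q \<in> polys_over A"
    using PQ assms by (auto simp: polys_over_def coeff_mult is_subring_def intro!: is_subring_sum[OF assms])
qed (use assms in \<open>auto simp: polys_over_def is_subring_def coeff_1\<close>)

lemma smult_in_polys_over:
  "is_subring A \<Longrightarrow> a \<in> A \<Longrightarrow> P \<in> polys_over A \<Longrightarrow> Polynomial.smult a P \<in> polys_over A"
  by (auto simp: polys_over_def is_subring_def)

lemma monom_in_polys_over:
  "is_subring A \<Longrightarrow> a \<in> A \<Longrightarrow> Polynomial.monom a n \<in> polys_over A"
  by (auto simp: polys_over_def is_subring_def coeff_monom)

text \<open>In the application \<open>A\<close> consists of the polynomials in the variables treated
  so far, \<open>\<alpha>\<close> evaluates them in the ring containing \<open>I\<close>, and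
  \<open>\<zeta>\<close> evaluates them at the point already found. The next variable has the value
  \<open>b\<close> in that ring.\<close>

locale specialization =
  \<alpha>: comm_ring_hom \<alpha> + \<zeta>: comm_ring_hom \<zeta>
  for \<alpha> :: "'m::comm_ring_1 \<Rightarrow> 'b::comm_ring_1" and \<zeta> :: "'m \<Rightarrow> 'k::field" +
  fixes A :: "'m set" and I :: "'b set" and b :: 'b
  assumes A: "is_subring A" and I: "is_ideal I"
begin

sublocale \<alpha>p: map_poly_comm_ring_hom \<alpha> ..
sublocale \<zeta>p: map_poly_comm_ring_hom \<zeta> ..

abbreviation ev :: "'m poly \<Rightarrow> 'b"
  where "ev P \<equiv> poly (map_poly \<alpha> P) b"

lemma mult_in_A: "x \<in> A \<Longrightarrow> y \<in> A \<Longrightarrow> x * y \<in> A"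
  using A by (auto simp: is_subring_def)

text \<open>
  The Euclidean algorithm without division: a top coefficient of \<open>P\<close> is removed with \<open>G\<close>, and a
  constant coefficient of \<open>G\<close> with \<open>P\<close>. After the latter step \<open>G\<close> is divisible by the indeterminate;
  as \<open>I\<close> need not be prime, the factor \<open>b\<close> that this division loses is recorded in the exponent \<open>n\<close>.
\<close>

lemma euclidean_elimination:
  assumes "P \<in> polys_over A" "G \<in> polys_over A" "b ^ n * ev P \<in> I" "b ^ n * ev G \<in> I"
    and "map_poly \<zeta> P = [:u:]" "u \<noteq> 0" "Polynomial.degree G \<le> e" "\<zeta> (Polynomial.coeff G e) \<noteq> 0"
  shows "\<exists>p\<in>A. \<exists>n. b ^ n * \<alpha> p \<in> I \<and> \<zeta> p \<noteq> 0"
  using assms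
proof (induction "Polynomial.degree P + e" arbitrary: P G e n u rule: less_induct)
  case less
  note PA = less.prems(1) and GA = less.prems(2) and u = less.prems(5,6)
  let ?d = "Polynomial.degree P"
  have coeff_u: "\<zeta> (Polynomial.coeff P i) = (if i = 0 then u else 0)" for i
    using arg_cong[OF u(1), of "\<lambda>p. Polynomial.coeff p i"] by (simp add: coeff_pCons split: nat.splits)
  have coeff_A: "Polynomial.coeff P i \<in> A" "Polynomial.coeff G i \<in> A" for i
    using PA GA by (auto simp: polys_over_def)
  consider "?d = 0" | "?d > 0" "?d \<ge> e" | "?d < e" by linarith
  then show ?case
  proof cases
    case 1
    then obtain p where P: "P = [:p:]" by (rule degree_eq_zeroE)
    have "p \<in> A" using coeff_A(1)[of 0] by (simp add: P)
    then show ?thesis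
      using less.prems(3) coeff_u[of 0] u(2) by (auto simp: P hom_distribs)
  next
    case 2
    define g where "g = Polynomial.coeff G e"
    define Q where "Q = Polynomial.monom (Polynomial.lead_coeff P) (?d - e)"
    define P' where "P' = Polynomial.smult g P - Q * G"
    have gA: "g \<in> A" and QA: "Q \<in> polys_over A"
      using coeff_A A by (auto simp: g_def Q_def intro: monom_in_polys_over)
    have PA': "P' \<in> polys_over A"
      using is_subring_polys_over[OF A] smult_in_polys_over[OF A gA PA] QA GA
      by (auto simp: P'_def is_subring_def)
    have "Polynomial.degree (Q * G) \<le> ?d"
      using degree_mult_le[of Q G] degree_monom_le[of "Polynomial.lead_coeff P" "?d - e"] less.prems(7) 2
      by (simp add: Q_def)
    moreover have "Polynomial.degree (Polynomial.smult g P) \<le> ?d"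
      by (rule degree_smult_le)
    ultimately have le: "Polynomial.degree P' \<le> ?d"
      unfolding P'_def by (rule degree_diff_le[rotated])
    have "Polynomial.coeff P' ?d = 0"
      using 2 by (simp add: P'_def Q_def g_def coeff_monom_mult)
    then have deg: "Polynomial.degree P' < ?d"
      using le 2(1) eq_zero_or_degree_less by fastforce
    \<comment> \<open>\<open>Q\<close> carries the top coefficient of \<open>P\<close>, which
      \<open>\<zeta>\<close> kills because it sits in positive degree. So \<open>P'\<close> still
      specializes to a nonzero constant.\<close>
    have Q0: "map_poly \<zeta> Q = 0"
      using coeff_u[of ?d] 2(1) by (simp add: Q_def map_poly_monom)
    have "b ^ n * ev P' = \<alpha> g * (b ^ n * ev P) - ev Q * (b ^ n * ev G)"
      by (simp add: P'_def hom_distribs algebra_simps)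
    then have I': "b ^ n * ev P' \<in> I"
      using less.prems(3,4) I by (simp add: is_ideal_diff is_ideal_mult)
    have "map_poly \<zeta> P' = [:\<zeta> g * u:]"
      by (simp add: P'_def hom_distribs Q0 u)
    moreover have "\<zeta> g * u \<noteq> 0"
      using less.prems(6,8) by (simp add: g_def)
    ultimately show ?thesis
      using less.hyps[OF _ PA' GA I' less.prems(4) _ _ less.prems(7,8)] deg by simp
  next
    case 3
    define p where "p = Polynomial.coeff P 0"
    define g where "g = Polynomial.coeff G 0"
    define G' where "G' = Polynomial.smult p G - Polynomial.smult g P"
    obtain c H where G': "G' = pCons c H" by (rule pCons_cases)
    have "Polynomial.coeff G' 0 = 0"
      by (simp add: G'_def p_def g_def)
    then have G'H: "G' = pCons 0 H" by (simp add: G')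
    have coeff_H: "Polynomial.coeff H i = Polynomial.coeff G' (Suc i)" for i
      by (simp add: G'H)
    have "G' \<in> polys_over A"
      using is_subring_polys_over[OF A] smult_in_polys_over[OF A _ PA] smult_in_polys_over[OF A _ GA] coeff_A
      by (auto simp: G'_def p_def g_def is_subring_def)
    then have HA: "H \<in> polys_over A"
      by (auto simp: polys_over_def coeff_H)
    have degH: "Polynomial.degree H \<le> e - 1"
    proof (rule degree_le, intro allI impI)
      fix i assume "e - 1 < i"
      then show "Polynomial.coeff H i = 0"
        using 3 less.prems(7) by (simp add: coeff_H G'_def coeff_eq_0)
    qed
    \<comment> \<open>As \<open>P\<close> has degree below \<open>e\<close>, only \<open>G\<close>
      contributes at this position, and the factor \<open>p\<close> specializes to
      \<open>u\<close>.\<close>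
    have "\<zeta> (Polynomial.coeff H (e - 1)) = \<zeta> p * \<zeta> (Polynomial.coeff G e)"
      using 3 by (simp add: coeff_H G'_def coeff_eq_0 hom_distribs)
    then have lead: "\<zeta> (Polynomial.coeff H (e - 1)) \<noteq> 0"
      using coeff_u[of 0] less.prems(6,8) by (simp add: p_def)
    have "b ^ Suc n * ev H = b ^ n * ev G'"
      by (simp add: G'H hom_distribs algebra_simps)
    also have "\<dots> = \<alpha> p * (b ^ n * ev G) - \<alpha> g * (b ^ n * ev P)"
      by (simp add: G'_def hom_distribs algebra_simps)
    finally have IH: "b ^ Suc n * ev H \<in> I"
      using less.prems(3,4) I by (simp add: is_ideal_diff is_ideal_mult)
    have IP: "b ^ Suc n * ev P \<in> I"
      using is_ideal_mult[OF I less.prems(3), of b] by (simp add: mult.assoc)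
    show ?thesis
      using less.hyps[OF _ PA HA IP IH u degH lead] 3 by simp
  qed
qed

text \<open>This is the properness of the specialized ideal. A nonzero \<open>u\<close> would let
  the elimination produce an element of \<open>A\<close> that \<open>\<zeta>\<close> does not kill,
  with \<open>\<alpha>\<close> sending it into \<open>I\<close> up to a power of \<open>b\<close>;
  once that power is removed, \<open>ker\<close> is contradicted.\<close>

lemma constant_specialization_eq_0:
  assumes "P \<in> polys_over A" "ev P \<in> I" "map_poly \<zeta> P = [:u:]"
    and "G \<in> polys_over A" "ev G \<in> I" "\<zeta> (Polynomial.lead_coeff G) \<noteq> 0"
    and ker: "\<And>p. p \<in> A \<Longrightarrow> \<alpha> p \<in> I \<Longrightarrow> \<zeta> p = 0"
  shows "u = 0"
proof (rule ccontr)
  assume u: "u \<noteq> 0"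
  obtain p n where p: "p \<in> A" "b ^ n * \<alpha> p \<in> I" "\<zeta> p \<noteq> 0"
    using euclidean_elimination[of P G 0 u "Polynomial.degree G"] assms u by auto
  obtain p0 Q where P: "P = pCons p0 Q" by (rule pCons_cases)
  have p0: "p0 \<in> A" "\<zeta> p0 = u"
    using assms(1,3) by (auto simp: P polys_over_def coeff_pCons hom_distribs split: nat.splits)
  \<comment> \<open>\<open>ev P = \<alpha> p0 + b * ev Q\<close> lies in \<open>I\<close>, so powers of \<open>b\<close> can be traded for powers of \<open>\<alpha> p0\<close>.\<close>
  have trade: "\<alpha> p0 ^ n * x \<in> I" if "b ^ n * x \<in> I" for n x
    using that
  proof (induction n arbitrary: x)
    case (Suc n)
    have "\<alpha> p0 ^ n * (b * x) \<in> I"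
      using Suc.IH[of "b * x"] Suc.prems by (simp add: mult_ac)
    moreover have "\<alpha> p0 ^ Suc n * x = (\<alpha> p0 ^ n * x) * ev P - ev Q * (\<alpha> p0 ^ n * (b * x))"
      by (simp add: P hom_distribs algebra_simps)
    ultimately show ?case
      using I assms(2) by (simp add: is_ideal_diff is_ideal_mult)
  qed simp
  have "p0 ^ n * p \<in> A"
    using is_subring_power[OF A p0(1)] p(1) by (rule mult_in_A)
  moreover have "\<alpha> (p0 ^ n * p) \<in> I"
    using trade[OF p(2)] by (simp add: hom_distribs)
  ultimately have "\<zeta> (p0 ^ n * p) = 0"
    by (rule ker)
  then show False
    using p(3) p0(2) u by (simp add: hom_distribs)
qed

end


text \<open>The section \<open>\<sigma>\<close> lifts polynomials over the field coefficientwise to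
  polynomials over \<open>A\<close>, so that quotients formed over the field can be used inside the
  ideal. The condition at 0 lets \<open>map_poly\<close> act coefficientwise.\<close>

locale specialization_alg_closed = specialization \<alpha> \<zeta> A I b
  for \<alpha> :: "'m::comm_ring_1 \<Rightarrow> 'b::comm_ring_1" and \<zeta> :: "'m \<Rightarrow> 'k::alg_closed_field" and A I b +
  fixes \<sigma> :: "'k \<Rightarrow> 'm"
  assumes \<sigma>: "\<sigma> 0 = 0" "\<And>c. \<sigma> c \<in> A" "\<And>c. \<zeta> (\<sigma> c) = c"
begin

text \<open>The specialized ideal is principal: a nonzero member of least degree divides all the
  others. It is not constant by \<open>constant_specialization_eq_0\<close>, so it has a root, which
  is then common to all members.\<close>

lemma common_root:
  assumes G: "G \<in> polys_over A" "ev G \<in> I" "\<zeta> (Polynomial.lead_coeff G) \<noteq> 0"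
    and ker: "\<And>p. p \<in> A \<Longrightarrow> \<alpha> p \<in> I \<Longrightarrow> \<zeta> p = 0"
  shows "\<exists>c. \<forall>P\<in>polys_over A. ev P \<in> I \<longrightarrow> poly (map_poly \<zeta> P) c = 0"
proof -
  define J where "J = {P \<in> polys_over A. ev P \<in> I}"
  define nz where "nz = (\<lambda>P. P \<in> J \<and> map_poly \<zeta> P \<noteq> 0)"
  have "map_poly \<zeta> G \<noteq> 0"
  proof
    assume 0: "map_poly \<zeta> G = 0"
    have "\<zeta> (Polynomial.lead_coeff G) = Polynomial.coeff (map_poly \<zeta> G) (Polynomial.degree G)"
      by simp
    then have "\<zeta> (Polynomial.lead_coeff G) = 0"
      by (simp only: 0 coeff_0)
    with G(3) show False ..
  qed
  then have "nz G"
    using G(1,2) by (auto simp: nz_def J_def)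
  then obtain H where H: "nz H" and
    min: "\<And>P. nz P \<Longrightarrow> Polynomial.degree (map_poly \<zeta> H) \<le> Polynomial.degree (map_poly \<zeta> P)"
    using ex_has_least_nat[of nz G "\<lambda>P. Polynomial.degree (map_poly \<zeta> P)"] by blast
  let ?h = "map_poly \<zeta> H"
  have HJ: "H \<in> polys_over A" "ev H \<in> I" and h0: "?h \<noteq> 0"
    using H by (auto simp: nz_def J_def)
  have "Polynomial.degree ?h \<noteq> 0"
  proof
    assume "Polynomial.degree ?h = 0"
    then obtain u where "?h = [:u:]" by (rule degree_eq_zeroE)
    then show False
      using constant_specialization_eq_0[OF HJ _ G ker] h0 by simp
  qed
  then obtain c where c: "poly ?h c = 0"
    using alg_closed_imp_poly_has_root by blast
  have "poly (map_poly \<zeta> P) c = 0" if P: "P \<in> polys_over A" "ev P \<in> I" for P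
  proof -
    let ?f = "map_poly \<zeta> P"
    \<comment> \<open>Lifting the quotient keeps \<open>P - Q * H\<close> in the ideal while it
      specializes to the remainder, which minimality forces to vanish.\<close>
    define Q where "Q = map_poly \<sigma> (?f div ?h)"
    have QA: "Q \<in> polys_over A"
      using \<sigma> by (auto simp: Q_def polys_over_def coeff_map_poly)
    have Q: "map_poly \<zeta> Q = ?f div ?h"
      by (rule poly_eqI) (simp add: Q_def coeff_map_poly \<sigma>)
    have "P - Q * H \<in> J"
      using P HJ QA is_subring_polys_over[OF A] I
      by (auto simp: J_def is_subring_def hom_distribs is_ideal_diff is_ideal_mult)
    moreover have mod: "map_poly \<zeta> (P - Q * H) = ?f mod ?h"
      by (simp add: hom_distribs Q minus_div_mult_eq_mod)
    ultimately have "?f mod ?h = 0"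
      using min[of "P - Q * H"] degree_mod_less[OF h0, of ?f] by (force simp: nz_def)
    then have "?h dvd ?f" by (simp add: dvd_eq_mod_eq_0)
    then show ?thesis using c by (auto simp: dvd_def)
  qed
  then show ?thesis by blast
qed

end

section \<open>Construction of a zero, one coordinate at a time\<close>

lemma comm_ring_hom_comp:
  assumes "comm_ring_hom f" "comm_ring_hom g"
  shows "comm_ring_hom (\<lambda>x. f (g x))"
proof -
  interpret f: comm_ring_hom f by fact
  interpret g: comm_ring_hom g by fact
  show ?thesis by standard (simp_all add: f.hom_add g.hom_add f.hom_mult g.hom_mult)
qed

lemma comm_ring_hom_poly: "comm_ring_hom (\<lambda>P. poly P (c :: 'b::comm_ring_1))"
  by standard simp_all

lemma mp_eval_mp_const: "h 0 = 0 \<Longrightarrow> mp_eval h x (mp_const c) = h c"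
  by (simp add: mp_const_def mp_eval_single)

lemma mp_const_eq_0_iff [simp]: "mp_const c = 0 \<longleftrightarrow> c = 0"
  unfolding mp_const_def by (metis lookup_single_eq lookup_zero single_zero)

lemma mp_eval_0 [simp]: "mp_eval h x 0 = 0"
  by (simp add: mp_eval_def)

lemma mp_eval_var: "h 0 = 0 \<Longrightarrow> h 1 = 1 \<Longrightarrow> mp_eval h x (mp_var i) = x i"
  by (simp add: mp_var_def mp_eval_single mon_eval_def)

lemma is_subring_prod:
  assumes "is_subring A" "\<And>x. x \<in> Y \<Longrightarrow> f x \<in> A"
  shows "prod f Y \<in> A"
  using assms(2) by (induction Y rule: infinite_finite_induct)
    (use assms(1) in \<open>auto simp: is_subring_def\<close>)

lemma mp_eval_in_subring:
  assumes A: "is_subring A" and "\<And>c. h c \<in> A" "\<And>i. i \<in> mp_vars p \<Longrightarrow> x i \<in> A"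
  shows "mp_eval h x p \<in> A"
  unfolding mp_eval_def
proof (intro is_subring_sum[OF A])
  fix m assume m: "m \<in> Poly_Mapping.keys p"
  have "(\<Prod>i\<in>Poly_Mapping.keys m. x i ^ Poly_Mapping.lookup m i) \<in> A"
    by (intro is_subring_prod is_subring_power A assms(3)) (use m in \<open>auto simp: mp_vars_def\<close>)
  then show "h (Poly_Mapping.lookup p m) * (\<Prod>i\<in>Poly_Mapping.keys m. x i ^ Poly_Mapping.lookup m i) \<in> A"
    using A assms(2) by (auto simp: is_subring_def)
qed

lemma mp_vars_eq_empty: "mp_vars p = {} \<Longrightarrow> p = mp_const (Poly_Mapping.lookup p 0)"
  by (rule poly_mapping_eqI) (auto simp: mp_vars_def mp_const_def lookup_single when_def in_keys_iff)

lemma is_subring_mp_vars_subset: "is_subring {p :: ('a::comm_ring_1, 'i) mpoly. mp_vars p \<subseteq> V}"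
  unfolding is_subring_def
proof (intro conjI ballI CollectI)
  fix p q :: "('a, 'i) mpoly" assume pq: "p \<in> {p. mp_vars p \<subseteq> V}" "q \<in> {p. mp_vars p \<subseteq> V}"
  show "mp_vars (p - q) \<subseteq> V"
    using mp_vars_add[of p "- q"] pq by auto
  show "mp_vars (p * q) \<subseteq> V"
    using mp_vars_mult[of p q] pq by auto
qed (simp_all add: mp_vars_def)

text \<open>The polynomials whose value at \<open>y\<close> lies in \<open>I\<close> form a proper
  ideal, and \<open>z\<close> is a zero of it. The family \<open>y\<close> stays arbitrary in the
  induction because adding a variable changes the coordinates.\<close>

lemma exists_specialization:
  fixes \<iota> :: "'k::alg_closed_field \<Rightarrow> 'b::comm_ring_1" and y :: "'i::linorder \<Rightarrow> 'b"
  assumes \<iota>: "comm_ring_hom \<iota>" and I: "is_ideal I" "1 \<notin> I" and "finite V"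
  shows "\<exists>z. \<forall>p. mp_vars p \<subseteq> V \<longrightarrow> mp_eval \<iota> y p \<in> I \<longrightarrow> mp_eval (\<lambda>c. c) z p = 0"
  using \<open>finite V\<close>
proof (induction V arbitrary: y)
  case empty
  interpret \<iota>: comm_ring_hom \<iota> by fact
  have "p = 0" if p: "mp_vars p = {}" "mp_eval \<iota> y p \<in> I" for p :: "('k, 'i) mpoly"
  proof (rule ccontr)
    assume "p \<noteq> 0"
    define c where "c = Poly_Mapping.lookup p 0"
    have pc: "p = mp_const c"
      unfolding c_def by (rule mp_vars_eq_empty[OF p(1)])
    then have "c \<noteq> 0" using \<open>p \<noteq> 0\<close> by (auto simp: mp_const_def)
    have "\<iota> c \<in> I" using p(2) by (simp add: pc mp_eval_mp_const)
    then have "\<iota> (inverse c) * \<iota> c \<in> I" by (rule is_ideal_mult[OF I(1)])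
    then show False using I(2) \<open>c \<noteq> 0\<close> by (simp flip: \<iota>.hom_mult)
  qed
  then show ?case by (metis subset_empty mp_eval_0)
next
  case (insert v V)
  show ?case
  proof (cases "\<exists>g :: ('k, 'i) mpoly. g \<noteq> 0 \<and> mp_vars g \<subseteq> insert v V \<and> mp_eval \<iota> y g \<in> I")
    \<comment> \<open>Without a nontrivial relation the only polynomial to consider is 0, and any
      point will do.\<close>
    case False
    have "mp_eval (\<lambda>c. c) (\<lambda>_. 0) p = 0" if "mp_vars p \<subseteq> insert v V" "mp_eval \<iota> y p \<in> I" for p :: "('k, 'i) mpoly"
    proof -
      have "p = 0" using False that by blast
      then show ?thesis by simp
    qed
    then show ?thesis by blast
  next
    case True
    then obtain g :: "('k, 'i) mpoly" where g: "g \<noteq> 0" "mp_vars g \<subseteq> insert v V" "mp_eval \<iota> y g \<in> I"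
      by blast
    let ?W = "\<lambda>w m. \<Sum>i\<in>insert v V. w i * Poly_Mapping.lookup m i"
    obtain w :: "'i \<Rightarrow> nat" where wv: "w v = 1" and w_pos: "\<forall>i\<in>insert v V. 0 < w i"
      and w: "\<forall>m\<in>Poly_Mapping.keys g. \<forall>n\<in>Poly_Mapping.keys g. ?W w m = ?W w n \<longrightarrow>
        (\<forall>i\<in>insert v V. Poly_Mapping.lookup m i = Poly_Mapping.lookup n i)"
      using exists_separating_weight[OF insert.hyps(1) finite_keys insert.hyps(2), of g]
      by (elim exE conjE) (rule that)
    \<comment> \<open>In the new coordinates \<open>y'\<close> the relation \<open>g\<close> becomes monic in \<open>y v\<close>, up to a constant.\<close>
    define y' where "y' = (\<lambda>i. y i - y v ^ w i)"
    obtain z' where z': "\<And>p. mp_vars p \<subseteq> V \<Longrightarrow> mp_eval \<iota> y' p \<in> I \<Longrightarrow> mp_eval (\<lambda>c. c) z' p = (0::'k)"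
      using insert.IH[of y'] by blast
    define A where "A = {p :: ('k, 'i) mpoly. mp_vars p \<subseteq> V}"
    interpret \<iota>: comm_ring_hom \<iota> by fact
    have id_hom: "comm_ring_hom (\<lambda>c::'k. c)" by standard simp_all
    \<comment> \<open>Constant polynomials serve as the section: they contain no variables and
      evaluate to their coefficient.\<close>
    interpret specialization_alg_closed "mp_eval \<iota> y'" "mp_eval (\<lambda>c. c) z'" A I "y v" mp_const
      unfolding specialization_alg_closed_def specialization_def specialization_axioms_def
        specialization_alg_closed_axioms_def
      using comm_ring_hom_mp_eval[OF \<iota>] comm_ring_hom_mp_eval[OF id_hom] I is_subring_mp_vars_subset
      by (auto simp: A_def mp_eval_mp_const mp_const_def[of 0])
    \<comment> \<open>The old coordinates in terms of the new ones: \<open>y v\<close> becomes the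
      indeterminate, and \<open>y i\<close> equals \<open>y' i + y v ^ w i\<close>. Thus
      \<open>sub\<close> rewrites a polynomial as a univariate one over \<open>A\<close>.\<close>
    define x where "x = (\<lambda>i. if i = v then [:0, 1:] else [:mp_var i:] + Polynomial.monom (1 :: ('k, 'i) mpoly) (w i))"
    define sub where "sub = mp_eval (\<lambda>c. [:mp_const c:]) x"
    have sub_A: "sub p \<in> polys_over A" if "mp_vars p \<subseteq> insert v V" for p
      unfolding sub_def
    proof (rule mp_eval_in_subring[OF is_subring_polys_over[OF A]])
      show "[:mp_const c:] \<in> polys_over A" for c :: 'k
        using A by (auto simp: polys_over_def coeff_pCons A_def is_subring_def split: nat.splits)
      fix i assume "i \<in> mp_vars p"
      then have "i = v \<or> i \<in> V" using that by auto
      moreover have "[:0, 1:] \<in> polys_over A"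
        using A by (auto simp: polys_over_def coeff_pCons is_subring_def split: nat.splits)
      moreover have "[:mp_var i:] + Polynomial.monom 1 (w i) \<in> polys_over A" if "i \<in> V"
      proof -
        have "mp_var i \<in> A" "1 \<in> A" using that A by (auto simp: A_def is_subring_def)
        then have "[:mp_var i:] \<in> polys_over A" "Polynomial.monom 1 (w i) \<in> polys_over A"
          using A monom_in_polys_over[OF A, of "mp_var i" 0] by (auto simp: monom_0 intro: monom_in_polys_over)
        then show ?thesis
          using is_subring_sum[OF is_subring_polys_over[OF A], of "{True, False}"
            "\<lambda>t. if t then [:mp_var i:] else Polynomial.monom 1 (w i)"] by simp
      qed
      ultimately show "x i \<in> polys_over A" by (auto simp: x_def)
    qed
    have ev_sub: "ev (sub p) = mp_eval \<iota> y p" for p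
    proof -
      have "ev (sub p) = mp_eval (\<lambda>c. ev [:mp_const c:]) (\<lambda>i. ev (x i)) p"
        unfolding sub_def
        by (rule hom_mp_eval[OF comm_ring_hom_comp[OF comm_ring_hom_poly \<alpha>p.comm_ring_hom_axioms]])
      moreover have "ev [:mp_const c:] = \<iota> c" for c :: 'k
        by (simp add: hom_distribs mp_eval_mp_const)
      moreover have "ev (x i) = y i" for i
      proof -
        have "ev (x i) = (if i = v then y v else y' i + y v ^ w i)"
          by (simp add: x_def hom_distribs mp_eval_var poly_monom)
        then show ?thesis by (simp add: y'_def)
      qed
      ultimately show ?thesis by simp
    qed
    \<comment> \<open>A root \<open>c\<close> of the specialized polynomials thus yields the point
      sought: \<open>c\<close> at \<open>v\<close> and \<open>z' i + c ^ w i\<close>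
      elsewhere.\<close>
    have spec_sub: "poly (map_poly (mp_eval (\<lambda>c. c) z') (sub p)) c =
        mp_eval (\<lambda>c. c) (\<lambda>i. if i = v then c else z' i + c ^ w i) p" for p c
    proof -
      have "poly (map_poly (mp_eval (\<lambda>c. c) z') (sub p)) c =
          mp_eval (\<lambda>a. poly (map_poly (mp_eval (\<lambda>c. c) z') [:mp_const a:]) c)
            (\<lambda>i. poly (map_poly (mp_eval (\<lambda>c. c) z') (x i)) c) p"
        unfolding sub_def
        by (rule hom_mp_eval[OF comm_ring_hom_comp[OF comm_ring_hom_poly \<zeta>p.comm_ring_hom_axioms]])
      moreover have "poly (map_poly (mp_eval (\<lambda>c. c) z') [:mp_const a:]) c = a" for a :: 'k
        by (simp add: hom_distribs mp_eval_mp_const)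
      moreover have "poly (map_poly (mp_eval (\<lambda>c. c) z') (x i)) c = (if i = v then c else z' i + c ^ w i)" for i
        by (simp add: x_def hom_distribs mp_eval_var poly_monom)
      ultimately show ?thesis by simp
    qed
    let ?W = "\<lambda>m. \<Sum>i\<in>insert v V. w i * Poly_Mapping.lookup m i"
    \<comment> \<open>Here positivity of the weights and \<open>w v = 1\<close> enter: each
      \<open>x i\<close> is monic of degree \<open>w i\<close>, so a monomial is sent to a monic
      polynomial whose degree is its weight.\<close>
    have x_monic: "Polynomial.lead_coeff (x i) = 1" "Polynomial.degree (x i) = w i" if "i \<in> insert v V" for i
    proof -
      have pos: "0 < w i" using w_pos that by blast
      show deg: "Polynomial.degree (x i) = w i"
        using pos by (simp add: x_def wv degree_add_eq_right degree_monom_eq)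
      show "Polynomial.lead_coeff (x i) = 1"
        unfolding deg using pos by (auto simp: x_def wv coeff_pCons split: nat.splits)
    qed
    have mon_monic: "Polynomial.lead_coeff (mon_eval x m) = 1" "Polynomial.degree (mon_eval x m) = ?W m"
      if "Poly_Mapping.keys m \<subseteq> insert v V" for m
    proof -
      have m: "mon_eval x m = (\<Prod>i\<in>insert v V. x i ^ Poly_Mapping.lookup m i)"
        using insert.hyps that by (intro mon_eval_superset) auto
      have "x i \<noteq> 0" if "i \<in> insert v V" for i using x_monic(1)[OF that] by auto
      then show "Polynomial.degree (mon_eval x m) = ?W m"
        unfolding m using x_monic(2)
        by (subst degree_prod_eq_sum_degree) (auto simp: degree_power_eq mult.commute intro!: sum.cong)
      show "Polynomial.lead_coeff (mon_eval x m) = 1"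
        unfolding m lead_coeff_prod lead_coeff_power using x_monic(1) by simp
    qed
    have keys_g: "Poly_Mapping.keys m \<subseteq> insert v V" if "m \<in> Poly_Mapping.keys g" for m
      using g(2) that by (auto simp: mp_vars_def)
    \<comment> \<open>By separation the heaviest monomial is alone in its weight. It alone reaches
      the top degree of \<open>sub g\<close>, whose leading coefficient is therefore a nonzero
      constant and survives any specialization.\<close>
    obtain m0 where m0: "m0 \<in> Poly_Mapping.keys g" and max: "\<And>m. m \<in> Poly_Mapping.keys g \<Longrightarrow> ?W m \<le> ?W m0"
    proof -
      have "finite (?W ` Poly_Mapping.keys g)" "?W ` Poly_Mapping.keys g \<noteq> {}" using g(1) by auto
      then have "Max (?W ` Poly_Mapping.keys g) \<in> ?W ` Poly_Mapping.keys g" by (rule Max_in)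
      then obtain m0 where "m0 \<in> Poly_Mapping.keys g" "?W m0 = Max (?W ` Poly_Mapping.keys g)" by auto
      then show thesis using that[of m0] by simp
    qed
    have strict: "?W m < ?W m0" if "m \<in> Poly_Mapping.keys g" "m \<noteq> m0" for m
    proof (rule ccontr)
      assume "\<not> ?W m < ?W m0"
      then have "?W m = ?W m0" using max[OF that(1)] by simp
      then have *: "\<forall>i\<in>insert v V. Poly_Mapping.lookup m i = Poly_Mapping.lookup m0 i"
        using w that(1) m0 by blast
      have "m = m0"
      proof (rule poly_mapping_eqI)
        fix i show "Poly_Mapping.lookup m i = Poly_Mapping.lookup m0 i"
        proof (cases "i \<in> insert v V")
          case False
          then have "i \<notin> Poly_Mapping.keys m" "i \<notin> Poly_Mapping.keys m0"
            using keys_g that(1) m0 by blast+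
          then show ?thesis by (simp add: in_keys_iff)
        qed (use * in blast)
      qed
      then show False using that(2) by simp
    qed
    have summand: "Polynomial.coeff ([:mp_const (Poly_Mapping.lookup g m):] * mon_eval x m) n =
        (if m = m0 \<and> n = ?W m0 then mp_const (Poly_Mapping.lookup g m0) else 0)"
      if "m \<in> Poly_Mapping.keys g" "n \<ge> ?W m0" for m n
    proof (cases "m = m0 \<and> n = ?W m0")
      case True
      then show ?thesis using mon_monic[OF keys_g[OF m0]] by simp
    next
      case False
      then have "Polynomial.degree (mon_eval x m) < n"
        using strict[OF that(1)] that(2) mon_monic(2)[OF keys_g[OF that(1)]] by (cases "m = m0") auto
      then show ?thesis unfolding if_not_P[OF False] by (simp add: coeff_eq_0)
    qed
    have coeff_sub: "Polynomial.coeff (sub g) n = (if n = ?W m0 then mp_const (Poly_Mapping.lookup g m0) else 0)"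
      if "n \<ge> ?W m0" for n
    proof -
      have "Polynomial.coeff (sub g) n =
          (\<Sum>m\<in>Poly_Mapping.keys g. if m = m0 \<and> n = ?W m0 then mp_const (Poly_Mapping.lookup g m0) else 0)"
        unfolding sub_def mp_eval_altdef coeff_sum by (intro sum.cong refl summand that)
      also have "\<dots> = (\<Sum>m\<in>Poly_Mapping.keys g. if m = m0 then
          (if n = ?W m0 then mp_const (Poly_Mapping.lookup g m0) else 0) else 0)"
        by (intro sum.cong refl) auto
      also have "\<dots> = (if n = ?W m0 then mp_const (Poly_Mapping.lookup g m0) else 0)"
        using m0 by (simp add: sum.delta)
      finally show ?thesis .
    qed
    have nz: "mp_const (Poly_Mapping.lookup g m0) \<noteq> (0 :: ('k, 'i) mpoly)"
      using m0 by (metis in_keys_iff mp_const_eq_0_iff)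
    have coeff_W: "Polynomial.coeff (sub g) (?W m0) = mp_const (Poly_Mapping.lookup g m0)"
      by (simp add: coeff_sub)
    have "Polynomial.degree (sub g) = ?W m0"
    proof (rule antisym)
      show "Polynomial.degree (sub g) \<le> ?W m0"
        by (rule degree_le) (simp add: coeff_sub)
      show "?W m0 \<le> Polynomial.degree (sub g)"
        by (rule le_degree) (unfold coeff_W, rule nz)
    qed
    then have "Polynomial.lead_coeff (sub g) = mp_const (Poly_Mapping.lookup g m0)"
      by (simp only: coeff_W)
    then have "mp_eval (\<lambda>c. c) z' (Polynomial.lead_coeff (sub g)) = Poly_Mapping.lookup g m0"
      by (simp add: mp_eval_mp_const)
    moreover have "Poly_Mapping.lookup g m0 \<noteq> 0"
      using nz by (simp only: mp_const_eq_0_iff not_False_eq_True)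
    ultimately have lead: "mp_eval (\<lambda>c. c) z' (Polynomial.lead_coeff (sub g)) \<noteq> 0"
      by (simp only: not_False_eq_True)
    have ev_g: "ev (sub g) \<in> I"
      using g(3) by (simp only: ev_sub)
    have ker: "mp_eval (\<lambda>c. c) z' p = 0" if "p \<in> A" "mp_eval \<iota> y' p \<in> I" for p
      using z' that by (simp add: A_def)
    obtain c where c: "\<forall>P\<in>polys_over A. ev P \<in> I \<longrightarrow> poly (map_poly (mp_eval (\<lambda>c. c) z') P) c = 0"
      using common_root[OF sub_A[OF g(2)] ev_g lead ker] by blast
    have "mp_eval (\<lambda>c. c) (\<lambda>i. if i = v then c else z' i + c ^ w i) p = 0"
      if "mp_vars p \<subseteq> insert v V" "mp_eval \<iota> y p \<in> I" for p
    proof -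
      have "ev (sub p) \<in> I" using that(2) by (simp only: ev_sub)
      then have "poly (map_poly (mp_eval (\<lambda>c. c) z') (sub p)) c = 0"
        using c sub_A[OF that(1)] by blast
      then show ?thesis by (simp only: spec_sub)
    qed
    then show ?thesis by blast
  qed
qed

text \<open>If the \<open>q i\<close> did not generate 1, their ideal would be proper. Taking the
  variables themselves for \<open>y\<close> makes evaluation the identity, so
  \<open>exists_specialization\<close> gives a zero of this very ideal.\<close>

lemma nullstellensatz_alg_closed:
  fixes q :: "'j \<Rightarrow> ('k::alg_closed_field, 'n::{finite, linorder}) mpoly"
  assumes "finite S" and no_zero: "\<And>z. \<exists>i\<in>S. mp_eval (\<lambda>c. c) z (q i) \<noteq> 0"
  shows "\<exists>h. (\<Sum>i\<in>S. h i * q i) = 1"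
proof (rule ccontr)
  assume *: "\<nexists>h. (\<Sum>i\<in>S. h i * q i) = 1"
  define I where "I = range (\<lambda>h. \<Sum>i\<in>S. h i * q i)"
  have I: "(\<Sum>i\<in>S. h i * q i) \<in> I" for h
    unfolding I_def by (rule rangeI)
  have "is_ideal I"
    unfolding is_ideal_def
  proof (intro conjI ballI allI)
    show "0 \<in> I" using I[of "\<lambda>_. 0"] by simp
    fix a assume "a \<in> I"
    then obtain h where h: "a = (\<Sum>i\<in>S. h i * q i)" unfolding I_def by (rule rangeE)
    show "c * a \<in> I" for c
      using I[of "\<lambda>i. c * h i"] by (simp add: h sum_distrib_left mult.assoc)
    fix b assume "b \<in> I"
    then obtain h' where h': "b = (\<Sum>i\<in>S. h' i * q i)" unfolding I_def by (rule rangeE)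
    show "a + b \<in> I"
      using I[of "\<lambda>i. h i + h' i"] by (simp add: h h' sum.distrib distrib_right)
  qed
  moreover have "1 \<notin> I"
  proof
    assume "1 \<in> I"
    then obtain h where "1 = (\<Sum>i\<in>S. h i * q i)" unfolding I_def by (rule rangeE)
    then show False using * by (blast dest: sym)
  qed
  ultimately obtain z where z: "\<forall>p :: ('k, 'n) mpoly. mp_vars p \<subseteq> UNIV \<longrightarrow>
      mp_eval mp_const mp_var p \<in> I \<longrightarrow> mp_eval (\<lambda>c. c) z p = 0"
    using exists_specialization[OF comm_ring_hom_mp_const, of I UNIV mp_var] finite_UNIV by blast
  have "q j \<in> I" if "j \<in> S" for j
  proof -
    have "(\<Sum>i\<in>S. (if i = j then 1 else 0) * q i) = (\<Sum>i\<in>S. if i = j then q i else 0)"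
      by (intro sum.cong) auto
    also have "\<dots> = q j" using that assms(1) by simp
    finally have "q j = (\<Sum>i\<in>S. (if i = j then 1 else 0) * q i)" ..
    then show ?thesis using I[of "\<lambda>i. if i = j then 1 else 0"] by (simp only:)
  qed
  then have "\<forall>i\<in>S. mp_eval (\<lambda>c. c) z (q i) = 0"
    using z by (simp add: mp_eval_mp_var)
  then show False using no_zero[of z] by blast
qed

text \<open>The vector 1 is nonzero, hence independent over the base field, so a linear map may be
  prescribed on it and extended.\<close>

lemma exists_alg_closure_functional:
  "\<exists>\<phi> :: 'a::field alg_closure \<Rightarrow> 'a. (\<forall>x y. \<phi> (x + y) = \<phi> x + \<phi> y) \<and> (\<forall>c x. \<phi> (to_ac c * x) = c * \<phi> x) \<and> \<phi> 1 = 1"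
proof -
  interpret vector_space_pair "\<lambda>(c::'a) x. to_ac c * x" "(*) :: 'a \<Rightarrow> 'a \<Rightarrow> 'a"
    by standard (simp_all add: algebra_simps)
  have "vs1.independent {1}"
    by (simp add: vs1.dependent_single)
  then obtain \<phi> :: "'a alg_closure \<Rightarrow> 'a" where "Vector_Spaces.linear (\<lambda>c x. to_ac c * x) (*) \<phi>" "\<phi> 1 = 1"
    using linear_independent_extend[of "{1}" "\<lambda>_. 1"] by auto
  then show ?thesis
    by (auto simp: Vector_Spaces.linear_def module_hom_def module_hom_axioms_def)
qed

text \<open>The closed case applies after extension of scalars; a linear retraction of the closure
  onto the base field, applied to the coefficients, then brings the cofactors back.\<close>

theorem weak_nullstellensatz:
  fixes q :: "'j \<Rightarrow> ('a::field, 'n::{finite, linorder}) mpoly"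
  assumes "finite S" and no_zero: "\<nexists>z :: 'n \<Rightarrow> 'a alg_closure. \<forall>i\<in>S. mp_eval to_ac z (q i) = 0"
  shows "\<exists>h. (\<Sum>i\<in>S. h i * q i) = 1"
proof -
  have to_ac_hom: "comm_ring_hom (to_ac :: 'a \<Rightarrow> _)" by standard simp_all
  have lift_hom: "comm_ring_hom (\<lambda>c::'a. mp_const (to_ac c) :: ('a alg_closure, 'n) mpoly)"
    by (rule comm_ring_hom_comp[OF comm_ring_hom_mp_const to_ac_hom])
  \<comment> \<open>Extension of scalars; it leaves values at points of the closure
    unchanged.\<close>
  define lift :: "('a, 'n) mpoly \<Rightarrow> ('a alg_closure, 'n) mpoly"
    where "lift = mp_eval (\<lambda>c. mp_const (to_ac c)) mp_var"
  interpret lift: comm_ring_hom lift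
    unfolding lift_def by (rule comm_ring_hom_mp_eval[OF lift_hom])
  have lift_single: "lift (Poly_Mapping.single m c) = Poly_Mapping.single m (to_ac c)" for m c
    by (simp add: lift_def mp_eval_single mon_eval_mp_var mp_const_def mult_single)
  have id_hom: "comm_ring_hom (\<lambda>c::'a alg_closure. c)" by standard simp_all
  have "mp_eval (\<lambda>c. c) z (lift p) = mp_eval to_ac z p" for z p
    unfolding lift_def hom_mp_eval[OF comm_ring_hom_mp_eval[OF id_hom]]
    by (simp add: mp_eval_mp_const mp_eval_var)
  then obtain h where h: "(\<Sum>i\<in>S. h i * lift (q i)) = 1"
    using nullstellensatz_alg_closed[OF assms(1), of "\<lambda>i. lift (q i)"] no_zero by auto
  obtain \<phi> :: "'a alg_closure \<Rightarrow> 'a" where \<phi>: "\<And>x y. \<phi> (x + y) = \<phi> x + \<phi> y"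
    "\<And>c x. \<phi> (to_ac c * x) = c * \<phi> x" "\<phi> 1 = 1"
    using exists_alg_closure_functional by blast
  have \<phi>0: "\<phi> 0 = 0" using \<phi>(2)[of 0 0] by simp
  \<comment> \<open>\<open>\<Phi>\<close> is \<open>K[x]\<close>-linear and fixes 1, so it carries the certificate down to \<open>K[x]\<close>.\<close>
  define \<Phi> :: "('a alg_closure, 'n) mpoly \<Rightarrow> ('a, 'n) mpoly" where "\<Phi> = Poly_Mapping.map \<phi>"
  have lookup_\<Phi>: "Poly_Mapping.lookup (\<Phi> p) m = \<phi> (Poly_Mapping.lookup p m)" for p m
    by (simp add: \<Phi>_def Poly_Mapping.map.rep_eq \<phi>0 when_def)
  have \<Phi>_add: "\<Phi> (p + r) = \<Phi> p + \<Phi> r" for p r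
    by (rule poly_mapping_eqI) (simp add: lookup_\<Phi> lookup_add \<phi>)
  have \<Phi>_single: "\<Phi> (Poly_Mapping.single m c) = Poly_Mapping.single m (\<phi> c)" for m c
    by (rule poly_mapping_eqI) (simp add: lookup_\<Phi> lookup_single when_def \<phi>0)
  have \<Phi>0: "\<Phi> 0 = 0" using \<Phi>_single[of 0 0] by (simp add: \<phi>0)
  have single: "\<Phi> (Poly_Mapping.single m c * lift p) = \<Phi> (Poly_Mapping.single m c) * p" for m c p
    by (induction p rule: poly_mapping_single_add_induct)
      (simp_all add: lift.hom_add lift_single mult_single \<Phi>_single \<Phi>_add distrib_left \<phi>(2) mult.commute[of c] mult.commute[of "\<phi> c"])
  have \<Phi>_mult: "\<Phi> (r * lift p) = \<Phi> r * p" for r p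
    by (induction r rule: poly_mapping_single_add_induct) (simp_all add: single \<Phi>_add distrib_right)
  have \<Phi>_sum: "\<Phi> (\<Sum>i\<in>S. f i) = (\<Sum>i\<in>S. \<Phi> (f i))" for f
    using assms(1) by induction (simp_all add: \<Phi>0 \<Phi>_add)
  have "(\<Sum>i\<in>S. \<Phi> (h i) * q i) = \<Phi> (\<Sum>i\<in>S. h i * lift (q i))"
    by (simp add: \<Phi>_sum \<Phi>_mult)
  also have "\<dots> = 1"
    using \<Phi>_single[of 0 1] by (simp add: h \<phi>(3))
  finally show ?thesis by (rule exI[of _ "\<lambda>i. \<Phi> (h i)"])
qed

section \<open>Monomial orderings and factorization\<close>

locale monomial_order =
  fixes R :: "(('n::{finite, linorder} \<Rightarrow>\<^sub>0 nat) \<times> ('n \<Rightarrow>\<^sub>0 nat)) set"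
  assumes monomial_ordering: "monomial_ordering R"
begin

lemma ord_refl: "(s, s) \<in> R"
  and ord_trans: "(s, t) \<in> R \<Longrightarrow> (t, u) \<in> R \<Longrightarrow> (s, u) \<in> R"
  and ord_antisym: "(s, t) \<in> R \<Longrightarrow> (t, s) \<in> R \<Longrightarrow> s = t"
  and ord_total: "(s, t) \<in> R \<or> (t, s) \<in> R"
  and ord_add: "(s, t) \<in> R \<Longrightarrow> (s + u, t + u) \<in> R"
  and wf_ord: "wf (R - Id)"
proof -
  have lin: "refl R" "trans R" "antisym R" "total R"
    using monomial_ordering
    by (simp_all add: monomial_ordering_def well_order_on_def linear_order_on_def partial_order_on_def preorder_on_def)
  show refl: "(s, s) \<in> R" for s using lin(1) by (rule reflD)
  show "(s, t) \<in> R \<Longrightarrow> (t, u) \<in> R \<Longrightarrow> (s, u) \<in> R" using lin(2) by (rule transD)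
  show "(s, t) \<in> R \<Longrightarrow> (t, s) \<in> R \<Longrightarrow> s = t" using lin(3) by (rule antisymD)
  show "(s, t) \<in> R \<or> (t, s) \<in> R" using lin(4) refl unfolding total_on_def by (cases "s = t") blast+
  show "(s, t) \<in> R \<Longrightarrow> (s + u, t + u) \<in> R" using monomial_ordering unfolding monomial_ordering_def by blast
  show "wf (R - Id)" using monomial_ordering by (simp add: monomial_ordering_def well_order_on_def)
qed

lemma ord_add_strict:
  assumes "(s, t) \<in> R" "(u, v) \<in> R" "s \<noteq> t \<or> u \<noteq> v"
  shows "(s + u, t + v) \<in> R" "s + u \<noteq> t + v"
proof -
  have 1: "(s + u, t + u) \<in> R" using assms(1) by (rule ord_add)
  have 2: "(t + u, t + v) \<in> R" using ord_add[OF assms(2), of t] by (simp add: add.commute)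
  show "(s + u, t + v) \<in> R" using 1 2 by (rule ord_trans)
  show "s + u \<noteq> t + v"
  proof
    assume eq: "s + u = t + v"
    then have "s + u = t + u" using 1 2 by (metis ord_antisym)
    then show False using assms(3) eq by simp
  qed
qed

text \<open>Adding a nonzero \<open>s\<close> below 0 to a minimal exponent \<open>m\<close> would
  give the smaller exponent \<open>s + m\<close>.\<close>

lemma ord_zero: "(0, s) \<in> R"
proof (rule ccontr)
  assume "(0, s) \<notin> R"
  then have "(s, 0) \<in> R" "s \<noteq> 0" using ord_total ord_refl by blast+
  obtain m where m: "\<And>y. (y, m) \<in> R - Id \<Longrightarrow> False"
    by (rule wfE_min[OF wf_ord UNIV_I[of 0]]) (rule that, blast)
  have "(s + m, m) \<in> R" using ord_add[OF \<open>(s, 0) \<in> R\<close>, of m] by simp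
  then show False using m[of "s + m"] \<open>s \<noteq> 0\<close> by simp
qed

lemma lead_exp_eqI:
  assumes "m \<in> Poly_Mapping.keys p" "\<And>m'. m' \<in> Poly_Mapping.keys p \<Longrightarrow> (m', m) \<in> R"
  shows "lead_exp R p = m"
  unfolding lead_exp_def by (rule the_equality) (use assms ord_antisym in blast)+

lemma lead_exp:
  assumes "p \<noteq> 0"
  shows "lead_exp R p \<in> Poly_Mapping.keys p"
    and "\<And>m. m \<in> Poly_Mapping.keys p \<Longrightarrow> (m, lead_exp R p) \<in> R"
proof -
  have "\<exists>m\<in>M. \<forall>m'\<in>M. (m', m) \<in> R" if "finite M" "M \<noteq> {}" for M
    using that
  proof (induction rule: finite_ne_induct)
    case (singleton x)
    then show ?case by (simp add: ord_refl)
  next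
    case (insert x M)
    then obtain m where m: "m \<in> M" "\<And>m'. m' \<in> M \<Longrightarrow> (m', m) \<in> R" by blast
    show ?case
    proof (cases "(x, m) \<in> R")
      case True
      then show ?thesis using m by (intro bexI[of _ m]) auto
    next
      case False
      then have "(m, x) \<in> R" using ord_total by blast
      then have "(m', x) \<in> R" if "m' \<in> M" for m' using m(2)[OF that] ord_trans by blast
      then show ?thesis by (intro bexI[of _ x]) (auto simp: ord_refl)
    qed
  qed
  from this[of "Poly_Mapping.keys p"] obtain m where
    m: "m \<in> Poly_Mapping.keys p" "\<And>m'. m' \<in> Poly_Mapping.keys p \<Longrightarrow> (m', m) \<in> R"
    using assms by (auto simp: keys_eq_empty)
  with lead_exp_eqI[OF m] show "lead_exp R p \<in> Poly_Mapping.keys p"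
    "\<And>m. m \<in> Poly_Mapping.keys p \<Longrightarrow> (m, lead_exp R p) \<in> R" by auto
qed

lemma keys_minus_lead_term:
  "Poly_Mapping.keys (p - lead_term R p) = Poly_Mapping.keys p - {lead_exp R p}"
  for p :: "('a::field, 'n) mpoly"
  by (auto simp: in_keys_iff lookup_minus lead_term_def lookup_single when_def split: if_splits)

text \<open>The bound \<open>s + t\<close> is attained only by the pair \<open>s\<close>,
  \<open>t\<close>, so it is strict as soon as one factor lacks its own bound.\<close>

lemma keys_mult_less:
  fixes p q :: "('a::field, 'n) mpoly"
  assumes "m \<in> Poly_Mapping.keys (p * q)"
    and "\<And>a. a \<in> Poly_Mapping.keys p \<Longrightarrow> (a, s) \<in> R"
    and "\<And>b. b \<in> Poly_Mapping.keys q \<Longrightarrow> (b, t) \<in> R"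
    and "s \<notin> Poly_Mapping.keys p \<or> t \<notin> Poly_Mapping.keys q"
  shows "(m, s + t) \<in> R \<and> m \<noteq> s + t"
proof -
  obtain a b where ab: "a \<in> Poly_Mapping.keys p" "b \<in> Poly_Mapping.keys q" "m = a + b"
    using keys_mult[of p q] assms(1) by blast
  then have "a \<noteq> s \<or> b \<noteq> t" using assms(4) by blast
  then show ?thesis
    using ord_add_strict[OF assms(2)[OF ab(1)] assms(3)[OF ab(2)]] unfolding ab(3) by simp
qed

text \<open>With the leading terms split off, every other part of the product stays strictly below;
  the coefficient at the sum is a product of two nonzero field elements.\<close>

lemma lead_exp_mult:
  fixes p q :: "('a::field, 'n) mpoly"
  assumes "p \<noteq> 0" "q \<noteq> 0"
  shows "lead_exp R (p * q) = lead_exp R p + lead_exp R q"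
proof (rule lead_exp_eqI)
  let ?s = "lead_exp R p" and ?t = "lead_exp R q"
  let ?p' = "p - lead_term R p" and ?q' = "q - lead_term R q"
  note p = lead_exp[OF assms(1)] and q = lead_exp[OF assms(2)]
  have "p * q = lead_term R p * lead_term R q + (lead_term R p * ?q' + ?p' * q)"
    by (simp add: algebra_simps)
  moreover have "?s + ?t \<notin> Poly_Mapping.keys (lead_term R p * ?q')"
  proof
    assume *: "?s + ?t \<in> Poly_Mapping.keys (lead_term R p * ?q')"
    have "Poly_Mapping.keys (lead_term R p) \<subseteq> {?s}" by (simp add: lead_term_def)
    then show False
      using keys_mult_less[OF *, of ?s ?t] q(2) ord_refl by (auto simp only: keys_minus_lead_term)
  qed
  moreover have "?s + ?t \<notin> Poly_Mapping.keys (?p' * q)"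
  proof
    assume *: "?s + ?t \<in> Poly_Mapping.keys (?p' * q)"
    show False
      using keys_mult_less[OF *, of ?s ?t] p(2) q(2) by (auto simp only: keys_minus_lead_term)
  qed
  ultimately have "Poly_Mapping.lookup (p * q) (?s + ?t) = Poly_Mapping.lookup p ?s * Poly_Mapping.lookup q ?t"
    by (simp add: lookup_add in_keys_iff) (simp add: lead_term_def mult_single)
  then show "?s + ?t \<in> Poly_Mapping.keys (p * q)"
    using p(1) q(1) by (metis in_keys_iff mult_eq_0_iff)
  fix m assume "m \<in> Poly_Mapping.keys (p * q)"
  then obtain a b where ab: "a \<in> Poly_Mapping.keys p" "b \<in> Poly_Mapping.keys q" "m = a + b"
    using keys_mult[of p q] by blast
  then show "(m, ?s + ?t) \<in> R"
    using ord_add_strict(1)[OF p(2)[OF ab(1)] q(2)[OF ab(2)]] ord_refl[of "?s + ?t"] unfolding ab(3) by metis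
qed

text \<open>As 0 is the least exponent, no other exponent can occur, and a nonzero constant is
  invertible.\<close>

lemma lead_exp_eq_0_imp_unit:
  fixes p :: "('a::field, 'n) mpoly"
  assumes "p \<noteq> 0" "lead_exp R p = 0"
  shows "p dvd 1"
proof -
  have "m = 0" if "m \<in> Poly_Mapping.keys p" for m
    using lead_exp(2)[OF assms(1) that] ord_zero[of m] assms(2) ord_antisym by simp
  then have "mp_vars p = {}" by (auto simp: mp_vars_def)
  then have p: "p = mp_const (Poly_Mapping.lookup p 0)" by (rule mp_vars_eq_empty)
  then have "Poly_Mapping.lookup p 0 \<noteq> 0" using assms(1) by (metis mp_const_eq_0_iff)
  then have "1 = mp_const (Poly_Mapping.lookup p 0) * mp_const (inverse (Poly_Mapping.lookup p 0))"
    by (simp add: mp_const_def mult_single)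
  then show ?thesis using p by (metis dvd_triv_left)
qed

text \<open>Supplies the well-founded descent for factorization: removing a nonunit factor lowers
  the leading exponent.\<close>

lemma lead_exp_proper_factor:
  fixes p q :: "('a::field, 'n) mpoly"
  assumes "p * q \<noteq> 0" "\<not> q dvd 1"
  shows "(lead_exp R p, lead_exp R (p * q)) \<in> R - Id"
proof -
  have nz: "p \<noteq> 0" "q \<noteq> 0" using assms(1) by auto
  have "lead_exp R q \<noteq> 0" using lead_exp_eq_0_imp_unit nz(2) assms(2) by blast
  then show ?thesis
    using ord_add[OF ord_zero[of "lead_exp R q"], of "lead_exp R p"] by (simp add: lead_exp_mult[OF nz] add.commute)
qed

lemma exists_irreducible_divisor:
  fixes p :: "('a::field, 'n) mpoly"
  assumes "p \<noteq> 0" "\<not> p dvd 1"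
  shows "\<exists>q. Factorial_Ring.irreducible q \<and> q dvd p"
  using assms
proof (induction "lead_exp R p" arbitrary: p rule: wf_induct_rule[OF wf_ord])
  case (1 p)
  show ?case
  proof (cases "Factorial_Ring.irreducible p")
    case False
    then obtain a b where ab: "p = a * b" "\<not> a dvd 1" "\<not> b dvd 1"
      using 1(2,3) by (auto simp: Factorial_Ring.irreducible_def)
    have "(lead_exp R a, lead_exp R p) \<in> R - Id"
      using lead_exp_proper_factor[of a b] 1(2) ab by simp
    then obtain q where "Factorial_Ring.irreducible q" "q dvd a"
      using 1(1)[of a] ab 1(2) by auto
    then show ?thesis using ab(1) by auto
  qed auto
qed

end

section \<open>Factorization into pairwise non-associate irreducibles\<close>

definition irreducible_family :: "nat set \<Rightarrow> (nat \<Rightarrow> ('a::comm_ring_1, 'n::linorder) mpoly) \<Rightarrow> bool"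
  where "irreducible_family S q \<longleftrightarrow> finite S \<and> (\<forall>i\<in>S. Factorial_Ring.irreducible (q i)) \<and>
    (\<forall>i\<in>S. \<forall>j\<in>S. i \<noteq> j \<longrightarrow> \<not> (q i dvd q j \<and> q j dvd q i))"

lemma irreducible_family_subset: "irreducible_family S q \<Longrightarrow> T \<subseteq> S \<Longrightarrow> irreducible_family T q"
  unfolding irreducible_family_def using finite_subset by blast

text \<open>An irreducible divisor is split off repeatedly. It either raises the exponent of an
  associate already present, at the cost of a unit collected in \<open>u\<close>, or joins the
  family under a fresh index.\<close>

lemma (in monomial_order) exists_irreducible_factorization:
  fixes p :: "('a::field, 'n) mpoly"
  assumes "p \<noteq> 0"
  shows "\<exists>S q b u. irreducible_family S q \<and> u dvd 1 \<and> p = u * (\<Prod>i\<in>S. q i ^ b i)"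
  using assms
proof (induction "lead_exp R p" arbitrary: p rule: wf_induct_rule[OF wf_ord])
  case (1 p)
  show ?case
  proof (cases "p dvd 1")
    case True
    then show ?thesis
      by (intro exI[of _ "{}"] exI[of _ p]) (simp add: irreducible_family_def)
  next
    case False
    then obtain a p' where a: "Factorial_Ring.irreducible a" "p = p' * a"
      using exists_irreducible_divisor[OF 1(2)] by (metis dvdE mult.commute)
    have p': "(lead_exp R p', lead_exp R p) \<in> R - Id" "p' \<noteq> 0"
      using lead_exp_proper_factor[of p' a] 1(2) a by auto
    obtain S q b u where IH: "irreducible_family S q" "u dvd 1" "p' = u * (\<Prod>i\<in>S. q i ^ b i)"
      using 1(1)[OF p'] by blast
    have fin: "finite S" using IH(1) by (simp add: irreducible_family_def)
    show ?thesis
    proof (cases "\<exists>j\<in>S. q j dvd a \<and> a dvd q j")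
      case True
      then obtain j where j: "j \<in> S" "q j dvd a" "a dvd q j" by blast
      obtain v where v: "a = q j * v" using j(2) by (rule dvdE)
      \<comment> \<open>Cancelling \<open>a\<close> in \<open>a * (w * v) = a\<close> shows that
        \<open>v\<close>, by which the associates differ, is a unit.\<close>
      obtain w where w: "q j = a * w" using j(3) by (rule dvdE)
      have "a \<noteq> 0" using a(1) by auto
      moreover have "a * (w * v) = a * 1" using v w by (metis mult.assoc mult.right_neutral)
      ultimately have "1 = v * w" by (metis mult.commute mult_left_cancel)
      then have v1: "v dvd 1" by (rule dvdI)
      have prod: "(\<Prod>i\<in>S. q i ^ b i) * q j = (\<Prod>i\<in>S. q i ^ (b(j := Suc (b j))) i)"
        using prod.remove[OF fin j(1), of "\<lambda>i. q i ^ b i"]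
          prod.remove[OF fin j(1), of "\<lambda>i. q i ^ (b(j := Suc (b j))) i"]
        by (simp add: mult.assoc mult.commute mult.left_commute)
      have "p = (u * v) * ((\<Prod>i\<in>S. q i ^ b i) * q j)"
        unfolding a(2) IH(3) v by (simp only: mult.assoc mult.commute mult.left_commute)
      then have "p = (u * v) * (\<Prod>i\<in>S. q i ^ (b(j := Suc (b j))) i)"
        by (simp only: prod)
      moreover have "u * v dvd 1" using mult_dvd_mono[OF IH(2) v1] by simp
      ultimately show ?thesis using IH(1) by blast
    next
      case False
      obtain k where k: "k \<notin> S" using fin ex_new_if_finite infinite_UNIV_nat by blast
      define q' where "q' = q(k := a)"
      have q': "q' i = q i" if "i \<in> S" for i using that k by (auto simp: q'_def)
      have "(\<Prod>i\<in>S. q' i ^ (b(k := 1)) i) = (\<Prod>i\<in>S. q i ^ b i)"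
        using k by (intro prod.cong) (auto simp: q'_def)
      then have "p = u * (\<Prod>i\<in>insert k S. q' i ^ (b(k := 1)) i)"
        using fin k by (simp add: a(2) IH(3) q'_def mult_ac)
      moreover have "irreducible_family (insert k S) q'"
        using IH(1) False a(1) k unfolding irreducible_family_def by (auto simp: q'_def)
      ultimately show ?thesis using IH(2) by blast
    qed
  qed
qed

section \<open>The decomposition\<close>

text \<open>A basis of the span can be chosen inside \<open>G\<close>, and the coefficients are then
  absorbed into its members, since \<open>G\<close> is stable under nonzero scalars.\<close>

lemma (in vector_space) exists_independent_sum:
  assumes "x \<in> span G" and scale: "\<And>c y. y \<in> G \<Longrightarrow> c \<noteq> 0 \<Longrightarrow> scale c y \<in> G"
  shows "\<exists>F. finite F \<and> F \<subseteq> G \<and> independent F \<and> x = \<Sum>F"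
proof -
  obtain B where B: "B \<subseteq> G" "independent B" "G \<subseteq> span B"
    using maximal_independent_subset[of G] by blast
  have "x \<in> span B"
    using assms(1) B(3) span_minimal[OF B(3) subspace_span] by blast
  then obtain t u where t: "finite t" "t \<subseteq> B" "x = (\<Sum>a\<in>t. scale (u a) a)"
    unfolding span_explicit by blast
  \<comment> \<open>Vanishing coefficients are discarded, since \<open>G\<close> need not contain
    0.\<close>
  define t' where "t' = {a\<in>t. u a \<noteq> 0}"
  have fin: "finite t'" and t'B: "t' \<subseteq> B" and nz: "\<And>a. a \<in> t' \<Longrightarrow> u a \<noteq> 0"
    using t by (auto simp: t'_def)
  have x: "x = (\<Sum>a\<in>t'. scale (u a) a)"
    unfolding t(3) by (rule sum.mono_neutral_right) (use t(1) in \<open>auto simp: t'_def\<close>)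
  have ind: "independent t'"
    using B(2) t'B by (rule independent_mono)
  \<comment> \<open>Distinct independent vectors are never proportional. Hence rescaling merges no
    two summands, and the sum over the set \<open>F\<close> counts each once.\<close>
  have inj: "inj_on (\<lambda>a. scale (u a) a) t'"
  proof (rule inj_onI, rule ccontr)
    fix a b assume ab: "a \<in> t'" "b \<in> t'" "scale (u a) a = scale (u b) b" "a \<noteq> b"
    have "a = scale (inverse (u a)) (scale (u b) b)"
      using nz[OF ab(1)] by (simp flip: ab(3))
    moreover have "b \<in> span (t' - {a})"
      using ab by (intro span_base) auto
    ultimately have "a \<in> span (t' - {a})"
      by (metis span_scale)
    then show False using ind ab(1) by (auto simp: dependent_def)
  qed
  define F where "F = (\<lambda>a. scale (u a) a) ` t'"
  have "independent F"
  proof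
    assume "dependent F"
    then obtain v y where v: "y \<in> F" "v y \<noteq> 0" "(\<Sum>y\<in>F. scale (v y) y) = 0"
      using dependent_finite[of F] fin by (auto simp: F_def)
    have "(\<Sum>a\<in>t'. scale (v (scale (u a) a) * u a) a) = 0"
      using v(3) unfolding F_def by (subst (asm) sum.reindex[OF inj]) (simp add: scale_scale)
    moreover obtain a where "a \<in> t'" "y = scale (u a) a" using v(1) by (auto simp: F_def)
    ultimately have "dependent t'"
      using v(2) nz unfolding dependent_finite[OF fin]
      by (intro exI[of _ "\<lambda>a. v (scale (u a) a) * u a"]) auto
    then show False using ind by blast
  qed
  moreover have "x = \<Sum>F"
    unfolding F_def x by (subst sum.reindex[OF inj]) simp
  moreover have "F \<subseteq> G"
    using B(1) t'B nz by (auto simp: F_def intro!: scale)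
  moreover have "finite F" using fin by (simp add: F_def)
  ultimately show ?thesis by blast
qed

section \<open>Algebraic dependence among the denominator factors\<close>

lemma alg_independent_subset: "alg_independent S q \<Longrightarrow> T \<subseteq> S \<Longrightarrow> alg_independent T q"
  unfolding alg_independent_def by (meson subset_trans)

text \<open>Meant for expanding a fraction by the product of the \<open>q i ^ e i\<close>: each term
  of \<open>\<rho>\<close> then cancels the whole power \<open>e i + b i\<close> of some
  \<open>q i\<close> in the new denominator.\<close>

lemma exists_dominant_relation:
  fixes q :: "nat \<Rightarrow> ('a::field, 'n) mpoly" and b :: "nat \<Rightarrow> nat"
  assumes "finite S" "\<not> alg_independent S q"
  shows "\<exists>\<rho> e. mp_eval mp_const q \<rho> = (\<Prod>i\<in>S. q i ^ e i) \<and>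
    (\<forall>m\<in>Poly_Mapping.keys \<rho>. Poly_Mapping.keys m \<subseteq> S \<and> (\<exists>i\<in>S. e i + b i \<le> Poly_Mapping.lookup m i))"
proof -
  obtain \<kappa> :: "('a, nat) mpoly" where \<kappa>: "\<kappa> \<noteq> 0" "mp_vars \<kappa> \<subseteq> S" "mp_eval mp_const q \<kappa> = 0"
    using assms(2) unfolding alg_independent_def by blast
  interpret ev: comm_ring_hom "mp_eval mp_const q"
    by (rule comm_ring_hom_mp_eval[OF comm_ring_hom_mp_const])
  have ev_const: "mp_eval mp_const q (mp_const c) = mp_const c" for c :: 'a
    by (simp add: mp_eval_mp_const)
  \<comment> \<open>Over no variables, \<open>\<kappa>\<close> would be a nonzero constant with
    value 0. An element of \<open>S\<close> is required to obtain the weights.\<close>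
  have "S \<noteq> {}"
  proof
    assume "S = {}"
    then have c: "\<kappa> = mp_const (Poly_Mapping.lookup \<kappa> 0)"
      using \<kappa>(2) by (intro mp_vars_eq_empty) simp
    have "mp_const (Poly_Mapping.lookup \<kappa> 0) = (0 :: ('a, 'n) mpoly)"
      using \<kappa>(3) ev_const[of "Poly_Mapping.lookup \<kappa> 0"] c by metis
    then show False using c \<kappa>(1) by (metis mp_const_eq_0_iff)
  qed
  then obtain v where "v \<in> S" by blast
  then have S: "insert v (S - {v}) = S" and v: "v \<notin> S - {v}" by blast+
  obtain w where w: "\<forall>m\<in>Poly_Mapping.keys \<kappa>. \<forall>n\<in>Poly_Mapping.keys \<kappa>.
      (\<Sum>i\<in>S. w i * Poly_Mapping.lookup m i) = (\<Sum>i\<in>S. w i * Poly_Mapping.lookup n i) \<longrightarrow>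
      (\<forall>i\<in>S. Poly_Mapping.lookup m i = Poly_Mapping.lookup n i)"
    using exists_separating_weight[OF finite_Diff[OF assms(1)] finite_keys v, of \<kappa>] unfolding S
    by (elim exE conjE) (rule that)
  define W where "W = (\<lambda>m. \<Sum>i\<in>S. w i * Poly_Mapping.lookup m i)"
  have W_add: "W (m + n) = W m + W n" for m n
    by (simp add: W_def lookup_add distrib_left sum.distrib)
  have keys_\<kappa>: "Poly_Mapping.keys m \<subseteq> S" if "m \<in> Poly_Mapping.keys \<kappa>" for m
    using \<kappa>(2) that by (auto simp: mp_vars_def)
  obtain m1 where "m1 \<in> Poly_Mapping.keys \<kappa>" using \<kappa>(1) by (metis ex_in_conv keys_eq_empty)
  then obtain m0 where m0: "m0 \<in> Poly_Mapping.keys \<kappa>" and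
    min: "\<And>m. m \<in> Poly_Mapping.keys \<kappa> \<Longrightarrow> W m0 \<le> W m"
    using ex_has_least_nat[of "\<lambda>m. m \<in> Poly_Mapping.keys \<kappa>" m1 W] by blast
  have strict: "W m0 + 1 \<le> W m" if m: "m \<in> Poly_Mapping.keys \<kappa>" "m \<noteq> m0" for m
  proof (rule ccontr)
    assume "\<not> W m0 + 1 \<le> W m"
    then have "W m = W m0" using min[OF m(1)] by simp
    then have *: "\<forall>i\<in>S. Poly_Mapping.lookup m i = Poly_Mapping.lookup m0 i"
      using w m(1) m0 unfolding W_def by blast
    have "m = m0"
    proof (rule poly_mapping_eqI)
      fix i show "Poly_Mapping.lookup m i = Poly_Mapping.lookup m0 i"
      proof (cases "i \<in> S")
        case False
        then have "i \<notin> Poly_Mapping.keys m" "i \<notin> Poly_Mapping.keys m0"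
          using keys_\<kappa> m(1) m0 by blast+
        then show ?thesis by (simp add: in_keys_iff)
      qed (use * in blast)
    qed
    then show False using m(2) by simp
  qed
  define c where "c = Poly_Mapping.lookup \<kappa> m0"
  have c: "c \<noteq> 0" unfolding c_def by (rule m0[unfolded in_keys_iff])
  \<comment> \<open>The relation is solved for its lightest monomial: \<open>\<rho>\<close> takes
    the value of that monomial but has only strictly heavier terms.\<close>
  define \<kappa>' where "\<kappa>' = \<kappa> - Poly_Mapping.single m0 c"
  define \<rho> where "\<rho> = mp_const (- inverse c) * \<kappa>'"
  have "mp_eval mp_const q \<kappa>' = - (mp_const c * mon_eval q m0)"
    using \<kappa>(3) by (simp add: \<kappa>'_def ev.hom_minus mp_eval_single)
  moreover have "mp_const (- inverse c) * mp_const c = (- 1 :: ('a, 'n) mpoly)"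
    using c by (simp add: mp_const_def mult_single single_uminus)
  ultimately have ev_\<rho>: "mp_eval mp_const q \<rho> = mon_eval q m0"
    by (simp add: \<rho>_def ev.hom_mult ev_const mult.assoc[symmetric])
  have keys_\<rho>: "Poly_Mapping.keys m \<subseteq> S \<and> W m0 + 1 \<le> W m" if "m \<in> Poly_Mapping.keys \<rho>" for m
  proof -
    have "m \<in> Poly_Mapping.keys \<kappa>'"
      using that keys_mult[of "mp_const (- inverse c)" \<kappa>'] by (auto simp: \<rho>_def mp_const_def split: if_splits)
    then have "m \<in> Poly_Mapping.keys \<kappa>" "m \<noteq> m0"
      by (auto simp: \<kappa>'_def c_def in_keys_iff lookup_minus lookup_single when_def split: if_splits)
    then show ?thesis using keys_\<kappa> strict by blast
  qed
  have keys_power: "Poly_Mapping.keys m \<subseteq> S \<and> t * (W m0 + 1) \<le> W m" if "m \<in> Poly_Mapping.keys (\<rho> ^ t)" for m t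
    using that
  proof (induction t arbitrary: m)
    case (Suc t)
    then obtain m1 m2 where m: "m1 \<in> Poly_Mapping.keys \<rho>" "m2 \<in> Poly_Mapping.keys (\<rho> ^ t)" "m = m1 + m2"
      using keys_mult[of \<rho> "\<rho> ^ t"] by auto
    have "Poly_Mapping.keys m \<subseteq> S"
      using Poly_Mapping.keys_add[of m1 m2] keys_\<rho>[OF m(1)] Suc.IH[OF m(2)] unfolding m(3) by blast
    moreover have "Suc t * (W m0 + 1) \<le> W m"
      using keys_\<rho>[OF m(1)] Suc.IH[OF m(2)] unfolding m(3) W_add by simp
    ultimately show ?case by blast
  qed simp
  \<comment> \<open>\<open>t\<close> exceeds the weight of \<open>b\<close> by one. A monomial with
    every exponent below \<open>e i + b i\<close> weighs at most \<open>t * W m0\<close> plus the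
    weight of \<open>b\<close>, which is less than the bound \<open>t * (W m0 + 1)\<close> valid on
    \<open>\<rho> ^ t\<close>.\<close>
  define t where "t = Suc (\<Sum>i\<in>S. w i * b i)"
  define e where "e = (\<lambda>i. t * Poly_Mapping.lookup m0 i)"
  have "mp_eval mp_const q (\<rho> ^ t) = (\<Prod>i\<in>S. q i ^ Poly_Mapping.lookup m0 i) ^ t"
    by (simp add: ev.hom_power ev_\<rho> mon_eval_superset[OF assms(1) keys_\<kappa>[OF m0]])
  also have "\<dots> = (\<Prod>i\<in>S. q i ^ e i)"
    by (simp add: prod_power_distrib e_def mult.commute flip: power_mult)
  finally have ev: "mp_eval mp_const q (\<rho> ^ t) = (\<Prod>i\<in>S. q i ^ e i)" .
  have "\<exists>i\<in>S. e i + b i \<le> Poly_Mapping.lookup m i" if "m \<in> Poly_Mapping.keys (\<rho> ^ t)" for m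
  proof (rule ccontr)
    assume "\<not> ?thesis"
    then have "W m \<le> (\<Sum>i\<in>S. w i * (e i + b i))"
      unfolding W_def by (intro sum_mono mult_left_mono) auto
    also have "\<dots> = t * W m0 + (\<Sum>i\<in>S. w i * b i)"
      by (simp add: W_def e_def distrib_left sum.distrib sum_distrib_left mult.left_commute)
    also have "\<dots> < t * (W m0 + 1)"
      by (simp add: t_def)
    finally show False using keys_power[OF that] by simp
  qed
  then show ?thesis using ev keys_power by blast
qed

section \<open>Fractions and the admissible summands\<close>

lemma Fract_sum:
  assumes "D \<noteq> 0"
  shows "Fract (sum f Y) D = (\<Sum>i\<in>Y. Fract (f i) D)"
proof (induction Y rule: infinite_finite_induct)
  case (insert i Y)
  have "Fract (f i) D + Fract (sum f Y) D = Fract (f i + sum f Y) D"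
    using assms by (simp add: eq_fract algebra_simps)
  then show ?case using insert by simp
qed (simp_all add: Zero_fract_def assms eq_fract)

lemma Fract_drop_factor:
  assumes "finite S" "i \<in> S" "q i \<noteq> 0"
  shows "Fract (q i ^ b i * r) (\<Prod>j\<in>S. q j ^ b j) = Fract r (\<Prod>j\<in>S - {i}. q j ^ b j)"
  using assms by (simp add: prod.remove[of S i] mult_fract_cancel)

lemma irreducible_family_prod_nonzero:
  fixes q :: "nat \<Rightarrow> ('a::field, 'n::linorder) mpoly"
  assumes "irreducible_family S q"
  shows "(\<Prod>i\<in>S. q i ^ b i) \<noteq> 0"
  using assms by (auto simp: irreducible_family_def)

text \<open>The summands of a Leinartas decomposition, gathered in a set so that the theorem reduces
  to two facts: the set spans, and it is stable under nonzero scalars.\<close>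

definition leinartas_terms ::
    "(('n \<Rightarrow>\<^sub>0 nat) \<times> ('n \<Rightarrow>\<^sub>0 nat)) set \<Rightarrow> ('a::field, 'n::linorder) mpoly fract set"
  where "leinartas_terms R = {h. \<exists>S q b r. irreducible_family S q \<and>
    h = Fract r (\<Prod>i\<in>S. q i ^ b i) \<and> (\<forall>i\<in>S. 0 < b i) \<and>
    (\<exists>z :: 'n \<Rightarrow> 'a alg_closure. \<forall>i\<in>S. mp_eval to_ac z (q i) = 0) \<and>
    alg_independent S q \<and> (\<forall>i\<in>S. \<not> lead_term R (q i) dvd r)}"

lemma leinartas_termsI:
  fixes q :: "nat \<Rightarrow> ('a::field, 'n::linorder) mpoly" and z :: "'n \<Rightarrow> 'a alg_closure"
  assumes "irreducible_family S q" "h = Fract r (\<Prod>i\<in>S. q i ^ b i)" "\<forall>i\<in>S. 0 < b i"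
    "\<forall>i\<in>S. mp_eval to_ac z (q i) = 0" "alg_independent S q" "\<forall>i\<in>S. \<not> lead_term R (q i) dvd r"
  shows "h \<in> leinartas_terms R"
  unfolding leinartas_terms_def mem_Collect_eq
  by (rule exI[of _ S], rule exI[of _ q], rule exI[of _ b], rule exI[of _ r])
    (intro conjI exI[of _ z] assms)

text \<open>The scalar goes into the numerator; as a unit it creates no new divisibility by a
  leading term.\<close>

lemma leinartas_terms_scale:
  fixes R :: "(('n::linorder \<Rightarrow>\<^sub>0 nat) \<times> ('n \<Rightarrow>\<^sub>0 nat)) set" and h :: "('a::field, 'n) mpoly fract"
  assumes "h \<in> leinartas_terms R" "c \<noteq> 0"
  shows "fract_scale c h \<in> leinartas_terms R"
proof -
  obtain S q b r and z :: "'n \<Rightarrow> 'a alg_closure" where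
    h: "irreducible_family S q" "h = Fract r (\<Prod>i\<in>S. q i ^ b i)" "\<forall>i\<in>S. 0 < b i" "\<forall>i\<in>S. mp_eval to_ac z (q i) = 0"
    "alg_independent S q" "\<forall>i\<in>S. \<not> lead_term R (q i) dvd r"
    using assms(1) unfolding leinartas_terms_def by blast
  have "fract_scale c h = Fract (mp_const c * r) (\<Prod>i\<in>S. q i ^ b i)"
    by (simp add: fract_scale_def h(2))
  moreover have "l dvd r" if "l dvd mp_const c * r" for l
  proof -
    have "mp_const (inverse c) * mp_const c = (1 :: ('a, 'n) mpoly)"
      using assms(2) by (simp add: mp_const_def mult_single)
    then show ?thesis
      using dvd_mult[OF that, of "mp_const (inverse c)"] by (simp only: mult.assoc[symmetric] mult_1)
  qed
  ultimately show ?thesis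
    using h(6) by (intro leinartas_termsI[OF h(1) _ h(3,4,5)]) blast+
qed

section \<open>Reduction of fractions to admissible ones\<close>

context monomial_order
begin

text \<open>Measures one reduction step: trading the leading term of \<open>l\<close> for the rest
  of \<open>l\<close> in \<open>r\<close> strictly lowers the leading exponent, unless the result is
  0.\<close>

lemma minus_lead_term_multiple:
  fixes r l :: "('a::field, 'n) mpoly"
  assumes "l \<noteq> 0" "r = lead_term R l * s" "s \<noteq> 0" "(l - lead_term R l) * s \<noteq> 0"
  shows "(lead_exp R ((l - lead_term R l) * s), lead_exp R r) \<in> R - Id"
proof -
  note l = lead_exp[OF assms(1)] and s = lead_exp[OF assms(3)]
  have "lead_exp R (lead_term R l) = lead_exp R l"
    using l(1) by (intro lead_exp_eqI) (auto simp: lead_term_def ord_refl split: if_splits)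
  moreover have "lead_term R l \<noteq> 0"
    using l(1) unfolding lead_term_def by (metis in_keys_iff lookup_single_eq lookup_zero)
  ultimately have r: "lead_exp R r = lead_exp R l + lead_exp R s"
    using lead_exp_mult assms(2,3) by metis
  have "lead_exp R ((l - lead_term R l) * s) \<in> Poly_Mapping.keys ((l - lead_term R l) * s)"
    by (rule lead_exp(1)[OF assms(4)])
  then have "(lead_exp R ((l - lead_term R l) * s), lead_exp R l + lead_exp R s) \<in> R \<and>
      lead_exp R ((l - lead_term R l) * s) \<noteq> lead_exp R l + lead_exp R s"
    by (rule keys_mult_less) (auto simp: keys_minus_lead_term l s)
  then show ?thesis by (simp add: r)
qed

text \<open>Two nested inductions, on the sum of the \<open>b i\<close> and on the leading exponent
  of \<open>r\<close>. Writing a leading term as \<open>q i\<close> minus its remaining terms splits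
  the fraction into one that loses a factor \<open>q i\<close> and one with a smaller
  numerator.\<close>

lemma numerator_reduction:
  fixes q :: "nat \<Rightarrow> ('a::field, 'n) mpoly"
  assumes fam: "irreducible_family S q"
    and zero: "\<exists>z :: 'n \<Rightarrow> 'a alg_closure. \<forall>i\<in>S. mp_eval to_ac z (q i) = 0"
    and indep: "alg_independent S q"
  shows "Fract r (\<Prod>i\<in>S. q i ^ b i) \<in> fract_space.span (leinartas_terms R)"
proof (induction "\<Sum>i\<in>S. b i" arbitrary: b r rule: less_induct)
  case outer: less
  show ?case
  proof (induction "lead_exp R r" arbitrary: r rule: wf_induct_rule[OF wf_ord])
    case inner: (1 r)
    have fin: "finite S" using fam by (simp add: irreducible_family_def)
    \<comment> \<open>Exponents may have dropped to 0, whereas admissible summands have positive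
      ones. The common zero and the independence pass to the smaller index set.\<close>
    define T where "T = {i\<in>S. 0 < b i}"
    let ?D = "\<Prod>i\<in>S. q i ^ b i"
    have D: "?D \<noteq> 0" by (rule irreducible_family_prod_nonzero[OF fam])
    have DT: "?D = (\<Prod>i\<in>T. q i ^ b i)"
      by (rule prod.mono_neutral_right) (use fin in \<open>auto simp: T_def\<close>)
    have TS: "T \<subseteq> S" by (auto simp: T_def)
    show ?case
    proof (cases "r = 0 \<or> (\<forall>i\<in>T. \<not> lead_term R (q i) dvd r)")
      case True
      then show ?thesis
      proof
        assume "r = 0"
        then have "Fract r ?D = 0" using D by (simp add: Zero_fract_def eq_fract)
        then show ?thesis by (simp add: fract_space.span_zero)
      next
        assume r: "\<forall>i\<in>T. \<not> lead_term R (q i) dvd r"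
        have "irreducible_family T q" "alg_independent T q"
          using fam indep TS irreducible_family_subset alg_independent_subset by blast+
        moreover obtain z :: "'n \<Rightarrow> 'a alg_closure" where "\<forall>i\<in>T. mp_eval to_ac z (q i) = 0"
          using zero TS by blast
        moreover have "\<forall>i\<in>T. 0 < b i" by (simp add: T_def)
        ultimately have "Fract r ?D \<in> leinartas_terms R"
          using r unfolding DT by (intro leinartas_termsI[OF _ refl])
        then show ?thesis by (rule fract_space.span_base)
      qed
    next
      case False
      then obtain i where i: "i \<in> S" "0 < b i" "lead_term R (q i) dvd r" and r: "r \<noteq> 0"
        by (auto simp: T_def)
      obtain s where s: "r = lead_term R (q i) * s" using i(3) by (rule dvdE)
      have s0: "s \<noteq> 0" using r s by auto
      have q0: "q i \<noteq> 0" using fam i(1) by (auto simp: irreducible_family_def)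
      define r' where "r' = - ((q i - lead_term R (q i)) * s)"
      define b' where "b' = b(i := b i - 1)"
      have "(\<Sum>j\<in>S. b' j) < (\<Sum>j\<in>S. b j)"
        by (rule sum_strict_mono_ex1) (use fin i in \<open>auto simp: b'_def\<close>)
      then have 1: "Fract s (\<Prod>j\<in>S. q j ^ b' j) \<in> fract_space.span (leinartas_terms R)"
        by (rule outer)
      have "?D = q i ^ b i * (\<Prod>j\<in>S - {i}. q j ^ b j)"
        by (rule prod.remove[OF fin i(1)])
      also have "(\<Prod>j\<in>S - {i}. q j ^ b j) = (\<Prod>j\<in>S - {i}. q j ^ b' j)"
        by (intro prod.cong) (auto simp: b'_def)
      also have "q i ^ b i = q i * q i ^ b' i"
        using i(2) by (simp add: b'_def power_eq_if)
      also have "q i * q i ^ b' i * (\<Prod>j\<in>S - {i}. q j ^ b' j) = q i * (\<Prod>j\<in>S. q j ^ b' j)"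
        by (simp add: prod.remove[OF fin i(1)] mult.assoc)
      finally have D': "?D = q i * (\<Prod>j\<in>S. q j ^ b' j)" .
      have "Fract (q i * s) ?D \<in> fract_space.span (leinartas_terms R)"
        using 1 q0 by (simp only: D' mult_fract_cancel not_False_eq_True)
      moreover have "Fract r' ?D \<in> fract_space.span (leinartas_terms R)"
      proof (cases "r' = 0")
        \<comment> \<open>The leading exponent of 0 carries no information, so a vanishing numerator
          cannot be left to the induction.\<close>
        case True
        then have "Fract r' ?D = 0" using D by (simp add: Zero_fract_def eq_fract)
        then show ?thesis by (simp add: fract_space.span_zero)
      next
        case False
        have "lead_exp R r' = lead_exp R ((q i - lead_term R (q i)) * s)"
          unfolding r'_def lead_exp_def by (simp add: in_keys_iff)
        then have "(lead_exp R r', lead_exp R r) \<in> R - Id"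
          using minus_lead_term_multiple[OF q0 s s0] False by (simp add: r'_def)
        then show ?thesis by (rule inner)
      qed
      moreover have "Fract r ?D = Fract (q i * s) ?D + Fract r' ?D"
        using D by (simp add: s r'_def eq_fract algebra_simps)
      ultimately show ?thesis by (simp add: fract_space.span_add)
    qed
  qed
qed

text \<open>Induction on the number of factors: without a common zero or with an algebraic relation,
  every summand loses a factor entirely; otherwise only the numerator has to be reduced.\<close>

lemma Fract_in_span_leinartas_terms:
  fixes q :: "nat \<Rightarrow> ('a::field, 'n) mpoly"
  assumes "irreducible_family S q"
  shows "Fract r (\<Prod>i\<in>S. q i ^ b i) \<in> fract_space.span (leinartas_terms R)"
  using assms
proof (induction "card S" arbitrary: S r b rule: less_induct)
  case less
  have fin: "finite S" using less.prems by (simp add: irreducible_family_def)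
  have nz: "q i \<noteq> 0" if "i \<in> S" for i using less.prems that by (auto simp: irreducible_family_def)
  \<comment> \<open>A summand whose numerator cancels some \<open>q i\<close> completely is covered by the induction hypothesis.\<close>
  have drop: "Fract (q i ^ b i * r) (\<Prod>j\<in>S. q j ^ b j) \<in> fract_space.span (leinartas_terms R)"
    if i: "i \<in> S" for i r and b :: "nat \<Rightarrow> nat"
  proof -
    have "card (S - {i}) < card S" using fin i by (rule card_Diff1_less)
    moreover have "irreducible_family (S - {i}) q"
      using irreducible_family_subset[OF less.prems] by blast
    ultimately show ?thesis
      unfolding Fract_drop_factor[where q = q, OF fin i nz[OF i]] by (rule less.hyps)
  qed
  let ?D = "\<lambda>b. \<Prod>i\<in>S. q i ^ b i"
  have D: "?D b \<noteq> 0" for b by (rule irreducible_family_prod_nonzero[OF less.prems])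
  consider (no_zero) "\<nexists>z :: 'n \<Rightarrow> 'a alg_closure. \<forall>i\<in>S. mp_eval to_ac z (q i) = 0"
    | (dependent) "\<not> alg_independent S q"
    | (admissible) "\<exists>z :: 'n \<Rightarrow> 'a alg_closure. \<forall>i\<in>S. mp_eval to_ac z (q i) = 0" "alg_independent S q"
    by blast
  then show ?case
  proof cases
    case no_zero
    have to_ac_hom: "comm_ring_hom (to_ac :: 'a \<Rightarrow> _)" by standard simp_all
    \<comment> \<open>Powers have the same zeros, so the Nullstellensatz may be applied to the
      \<open>q i ^ b i\<close>, each summand of the certificate cancelling a full power.\<close>
    have "mp_eval to_ac z (q i) = 0" if "mp_eval to_ac z (q i ^ b i) = 0" for z i
    proof -
      interpret ev: comm_ring_hom "mp_eval to_ac z" by (rule comm_ring_hom_mp_eval[OF to_ac_hom])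
      show ?thesis using that by (simp add: ev.hom_power)
    qed
    then have "\<nexists>z :: 'n \<Rightarrow> 'a alg_closure. \<forall>i\<in>S. mp_eval to_ac z (q i ^ b i) = 0"
      using no_zero by blast
    then obtain h where h: "(\<Sum>i\<in>S. h i * q i ^ b i) = 1"
      using weak_nullstellensatz[OF fin, of "\<lambda>i. q i ^ b i"] by blast
    have "r * (\<Sum>i\<in>S. h i * q i ^ b i) = (\<Sum>i\<in>S. q i ^ b i * (r * h i))"
      unfolding sum_distrib_left
      by (intro sum.cong refl) (simp only: mult.assoc mult.commute mult.left_commute)
    then have "r = (\<Sum>i\<in>S. q i ^ b i * (r * h i))"
      by (simp only: h mult_1_right)
    then have "Fract r (?D b) = (\<Sum>i\<in>S. Fract (q i ^ b i * (r * h i)) (?D b))"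
      by (metis (no_types) Fract_sum[OF D])
    then show ?thesis
      by (simp only:) (intro fract_space.span_sum drop)
  next
    case dependent
    obtain \<rho> e where ev: "mp_eval mp_const q \<rho> = ?D e" and keys:
      "\<And>m. m \<in> Poly_Mapping.keys \<rho> \<Longrightarrow> Poly_Mapping.keys m \<subseteq> S \<and> (\<exists>i\<in>S. e i + b i \<le> Poly_Mapping.lookup m i)"
      using exists_dominant_relation[OF fin dependent, of b] by blast
    \<comment> \<open>Exponents of the denominator after expansion by \<open>?D e\<close>, which is
      then replaced in the numerator by the value of \<open>\<rho>\<close>.\<close>
    let ?e = "\<lambda>i. e i + b i"
    have De: "?D ?e = ?D e * ?D b"
      by (simp add: power_add prod.distrib)
    have "Fract r (?D b) = Fract (?D e * r) (?D ?e)"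
      unfolding De by (rule mult_fract_cancel[OF D, symmetric])
    also have "?D e * r = (\<Sum>m\<in>Poly_Mapping.keys \<rho>. mp_const (Poly_Mapping.lookup \<rho> m) * mon_eval q m * r)"
      unfolding ev[symmetric] mp_eval_altdef by (rule sum_distrib_right)
    also have "Fract \<dots> (?D ?e) =
        (\<Sum>m\<in>Poly_Mapping.keys \<rho>. Fract (mp_const (Poly_Mapping.lookup \<rho> m) * mon_eval q m * r) (?D ?e))"
      by (rule Fract_sum[OF D])
    also have "\<dots> \<in> fract_space.span (leinartas_terms R)"
    proof (rule fract_space.span_sum)
      fix m assume m: "m \<in> Poly_Mapping.keys \<rho>"
      obtain i where i: "i \<in> S" "?e i \<le> Poly_Mapping.lookup m i" using keys[OF m] by blast
      have "mon_eval q m = q i ^ Poly_Mapping.lookup m i * (\<Prod>j\<in>S - {i}. q j ^ Poly_Mapping.lookup m j)"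
        using keys[OF m] by (simp only: mon_eval_superset[OF fin] prod.remove[OF fin i(1)])
      also have "q i ^ Poly_Mapping.lookup m i = q i ^ ?e i * q i ^ (Poly_Mapping.lookup m i - ?e i)"
        using i(2) by (simp flip: power_add)
      finally have "mon_eval q m = q i ^ ?e i * (q i ^ (Poly_Mapping.lookup m i - ?e i) *
          (\<Prod>j\<in>S - {i}. q j ^ Poly_Mapping.lookup m j))"
        by (simp only: mult.assoc)
      then obtain g where g: "mon_eval q m = q i ^ ?e i * g" ..
      have "mp_const (Poly_Mapping.lookup \<rho> m) * mon_eval q m * r =
          q i ^ ?e i * (mp_const (Poly_Mapping.lookup \<rho> m) * g * r)"
        unfolding g by (simp only: mult.assoc mult.commute mult.left_commute)
      then show "Fract (mp_const (Poly_Mapping.lookup \<rho> m) * mon_eval q m * r) (?D ?e)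
          \<in> fract_space.span (leinartas_terms R)"
        using drop[OF i(1), of ?e] by (simp only:)
    qed
    finally show ?thesis .
  next
    case admissible
    then show ?thesis by (rule numerator_reduction[OF less.prems])
  qed
qed

lemma span_leinartas_terms: "f \<in> fract_space.span (leinartas_terms R)"
  for f :: "('a::field, 'n) mpoly fract"
proof (cases f)
  case (Fract N D)
  obtain S q b u where D: "irreducible_family S q" "u dvd 1" "D = u * (\<Prod>i\<in>S. q i ^ b i)"
    using exists_irreducible_factorization[OF Fract(2)] by blast
  obtain v where v: "1 = u * v" using D(2) by (rule dvdE)
  have "u \<noteq> 0" using v by auto
  \<comment> \<open>The unit in the factorization of the denominator moves to the numerator as its
    inverse \<open>v\<close>.\<close>
  moreover have "N = u * (v * N)" using v by (metis mult.assoc mult_1)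
  ultimately have "f = Fract (v * N) (\<Prod>i\<in>S. q i ^ b i)"
    using Fract(1) D(3) by (metis mult_fract_cancel)
  then show ?thesis using Fract_in_span_leinartas_terms[OF D(1)] by simp
qed

end

theorem mainTheorem4:
  fixes R :: "(('n::{finite,linorder} \<Rightarrow>\<^sub>0 nat) \<times> ('n \<Rightarrow>\<^sub>0 nat)) set"
    and f :: "('a::field, 'n) mpoly fract"
  assumes "monomial_ordering R"
  shows "\<exists>F. finite F \<and> fract_space.independent F \<and> f = \<Sum>F \<and>
    (\<forall>h\<in>F. \<exists>(S :: nat set) (q :: nat \<Rightarrow> ('a, 'n) mpoly) (b :: nat \<Rightarrow> nat) (r :: ('a, 'n) mpoly).
      finite S \<and>
      h = Fract r (\<Prod>i\<in>S. q i ^ b i) \<and>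
      (\<forall>i\<in>S. 0 < b i) \<and>
      (\<forall>i\<in>S. Factorial_Ring.irreducible (q i)) \<and>
      (\<forall>i\<in>S. \<forall>j\<in>S. i \<noteq> j \<longrightarrow> \<not> (q i dvd q j \<and> q j dvd q i)) \<and>
      (\<exists>z :: 'n \<Rightarrow> 'a alg_closure. \<forall>i\<in>S. mp_eval to_ac z (q i) = 0) \<and>
      alg_independent S q \<and>
      (\<forall>i\<in>S. \<not> lead_term R (q i) dvd r))"
proof -
  interpret monomial_order R by standard (rule assms)
  obtain F where F: "finite F" "F \<subseteq> leinartas_terms R" "fract_space.independent F" "f = \<Sum>F"
    using fract_space.exists_independent_sum[OF span_leinartas_terms leinartas_terms_scale] by blast
  show ?thesis
  proof (intro exI[of _ F] conjI ballI F(1,3,4))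
    fix h assume "h \<in> F"
    then have "h \<in> leinartas_terms R" using F(2) by blast
    then obtain S q b r where "irreducible_family S q \<and>
      h = Fract r (\<Prod>i\<in>S. q i ^ b i) \<and> (\<forall>i\<in>S. 0 < b i) \<and>
      (\<exists>z :: 'n \<Rightarrow> 'a alg_closure. \<forall>i\<in>S. mp_eval to_ac z (q i) = 0) \<and>
      alg_independent S q \<and> (\<forall>i\<in>S. \<not> lead_term R (q i) dvd r)"
      unfolding leinartas_terms_def mem_Collect_eq by (elim exE) (rule that)
    then show "\<exists>(S :: nat set) (q :: nat \<Rightarrow> ('a, 'n) mpoly) (b :: nat \<Rightarrow> nat) (r :: ('a, 'n) mpoly).
      finite S \<and>
      h = Fract r (\<Prod>i\<in>S. q i ^ b i) \<and>
      (\<forall>i\<in>S. 0 < b i) \<and>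
      (\<forall>i\<in>S. Factorial_Ring.irreducible (q i)) \<and>
      (\<forall>i\<in>S. \<forall>j\<in>S. i \<noteq> j \<longrightarrow> \<not> (q i dvd q j \<and> q j dvd q i)) \<and>
      (\<exists>z :: 'n \<Rightarrow> 'a alg_closure. \<forall>i\<in>S. mp_eval to_ac z (q i) = 0) \<and>
      alg_independent S q \<and>
      (\<forall>i\<in>S. \<not> lead_term R (q i) dvd r)"
      unfolding irreducible_family_def
      by (elim conjE)
        (rule exI[of _ S], rule exI[of _ q], rule exI[of _ b], rule exI[of _ r],
          (rule conjI, assumption)+, assumption)
  qed
qed

end
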